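(* Let $G$ be a finite simple plane graph (a planar graph with a fixed embedding in the plane) having at least two faces, and let $g(G)$ denote its Grinberg number. Then every closed, spanning walk on $G$ has at least $g(G)/2$ repeats of vertices; that is, if for each vertex $v$ of $G$ we let $m_v$ be the number of times $v$ occurs in the walk minus one, then $\sum_{v \in V(G)} m_v \ge \tfrac{1}{2} g(G)$.
   Context: Let the faces of the plane graph $G$ (including the unbounded one) be $F_1,\dots,F_N$, and let $|F|$ denote the length of a face $F$, i.e. the number of edges on its boundary. The Grinberg set $\mathscr{G}(G)$ is the set of all numbers $\left|\sum_{i=1}^N \varepsilon_i(|F_i|-2)\right|$ with $(\varepsilon_1,\dots,\varepsilon_N)\in\{-1,+1\}^N$, excluding the two sign vectors in which all components are equal. The Grinberg number is $g(G)=\min \mathscr{G}(G)$. A closed, spanning walk is a closed walk $v_{1},v_{2},\dots,v_{k},v_{k+1}=v_{1}$ (consecutive vertices adjacent) in which every vertex of $G$ occurs; the occurrences of a vertex are counted among $v_1,\dots,v_k$ (the final return to the start vertex is not counted separately). A vertex occurring exactly once contributes $0$ repeats. *)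

theory Defs
  imports "HOL-Analysis.Analysis"
begin

text \<open>The plane is \<^typ>\<open>complex\<close>, for which the library states the Jordan curve theorem. An edge is the
  point set of an arc, endpoints included; its endpoints are recovered as \<open>e \<inter> V\<close>. Since the path
  \<open>\<gamma>\<close> below is an arc, the two endpoints differ, so loops are excluded; \<open>no_parallel\<close> excludes
  multiple edges.\<close>

locale plane_graph =
  fixes V :: "complex set" and E :: "complex set set"
  assumes finite_V: "finite V"
    and finite_E: "finite E"
    and edge_arc: "e \<in> E \<Longrightarrow>
      \<exists>\<gamma>. arc \<gamma> \<and> path_image \<gamma> = e \<and> e \<inter> V = {pathstart \<gamma>, pathfinish \<gamma>}"
    and edges_meet_at_vertices: "e \<in> E \<Longrightarrow> e' \<in> E \<Longrightarrow> e \<noteq> e' \<Longrightarrow> e \<inter> e' \<subseteq> V"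
    and no_parallel: "e \<in> E \<Longrightarrow> e' \<in> E \<Longrightarrow> e \<inter> V = e' \<inter> V \<Longrightarrow> e = e'"

definition adjacent :: "complex set \<Rightarrow> complex set set \<Rightarrow> complex \<Rightarrow> complex \<Rightarrow> bool" where
  "adjacent V E u v \<longleftrightarrow> (\<exists>e\<in>E. e \<inter> V = {u, v})"

definition faces :: "complex set \<Rightarrow> complex set set \<Rightarrow> complex set set" where
  "faces V E = components (- (V \<union> \<Union>E))"

text \<open>Edges on the boundary are counted as a set, so a bridge counts once.\<close>

definition face_length :: "complex set set \<Rightarrow> complex set \<Rightarrow> nat" where
  "face_length E F = card {e \<in> E. e \<subseteq> frontier F}"

definition grinberg_set :: "complex set \<Rightarrow> complex set set \<Rightarrow> int set" where
  "grinberg_set V E =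
    {\<bar>\<Sum>F\<in>faces V E. \<epsilon> F * (int (face_length E F) - 2)\<bar> | \<epsilon>.
      (\<forall>F\<in>faces V E. \<epsilon> F \<in> {-1, 1}) \<and>
      (\<exists>F\<in>faces V E. \<exists>F'\<in>faces V E. \<epsilon> F \<noteq> \<epsilon> F')}"

definition grinberg_number :: "complex set \<Rightarrow> complex set set \<Rightarrow> int" where
  "grinberg_number V E = Min (grinberg_set V E)"

text \<open>A closed walk \<open>v\<^sub>1, \<dots>, v\<^sub>k, v\<^sub>1\<close> is given by the list \<open>[v\<^sub>1, \<dots>, v\<^sub>k]\<close>, without the final return.\<close>

definition closed_spanning_walk :: "complex set \<Rightarrow> complex set set \<Rightarrow> complex list \<Rightarrow> bool" where
  "closed_spanning_walk V E vs \<longleftrightarrow>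
    vs \<noteq> [] \<and> set vs = V \<and>
    (\<forall>i<length vs. adjacent V E (vs ! i) (vs ! (Suc i mod length vs)))"

end

theory Submission
  imports Defs
begin

text \<open>Let \<open>S\<close> be the set of edges used by the walk and \<open>H\<close> the edges used an odd number of times.
  Modulo two the walk is a sum of simple cycles, and these have exactly the edges of \<open>H\<close>; colour
  each point of the plane by the parity of the number of these cycles enclosing it. In the signed
  face sum an edge of \<open>H\<close> contributes \<open>0\<close>, an edge of \<open>S - H\<close> at most \<open>2\<close> in absolute value, and an
  edge outside \<open>S\<close> splits a face of the connected graph \<open>(V, S)\<close> in two faces of the same colour, so
  that its contribution cancels against the \<open>- 2\<close> of the additional face. What remains is
  \<open>- 2\<close> times the sum of the colours of the faces of \<open>(V, S)\<close>. By Euler's formula there are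
  \<open>|S| - |V| + 2\<close> of these, and they do not all have the same colour, so the signed face sum is at
  most \<open>2 (|S| + |S - H| - |V|)\<close>, and \<open>|S| + |S - H|\<close> is at most the length of the walk.

  If \<open>H\<close> is empty, the walk has length at least \<open>2 (|V| - 1)\<close>, and the same estimate is applied to the
  unique cycle in a spanning tree plus one edge.

  Topologically, only two facts are needed, both consequences of Janiszewski's theorem: an edge
  lying on a Jordan curve in the drawing separates exactly two faces, one inside and one outside
  that curve, and an edge joining two components of a drawing separates no faces.\<close>

section \<open>Components of complements of plane compacta\<close>

text \<open>If a connected \<open>D\<close> properly contained a part \<open>U\<close>, then
  \<open>U\<close> and the open union of the other parts would disconnect it; hence every part is a
  maximal connected subset.\<close>

lemma components_eq_partition:
  fixes A :: "'a::real_normed_vector set"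
  assumes "\<Union>\<U> = A" "disjoint \<U>"
    and "\<And>U. U \<in> \<U> \<Longrightarrow> open U \<and> connected U \<and> U \<noteq> {}"
  shows "components A = \<U>"
proof -
  have *: "\<U> \<subseteq> components A"
  proof
    fix U assume U: "U \<in> \<U>"
    have "D = U" if D: "U \<subseteq> D" "D \<subseteq> A" "connected D" for D
    proof (rule ccontr)
      assume "D \<noteq> U"
      moreover have "open (\<Union>(\<U> - {U}))" "U \<inter> \<Union>(\<U> - {U}) = {}" "A = U \<union> \<Union>(\<U> - {U})"
        using assms U by (auto simp: disjoint_def intro!: open_Union)
      ultimately show False
        using connectedD[OF D(3), of U "\<Union>(\<U> - {U})"] D(1,2) assms(3)[OF U] by blast
    qed
    then show "U \<in> components A"
      using assms U by (auto simp: in_components_maximal)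
  qed
  moreover have "components A \<subseteq> \<U>"
  proof
    fix C assume C: "C \<in> components A"
    then obtain x where "x \<in> C" "x \<in> A"
      using in_components_nonempty in_components_subset by blast
    then obtain U where "U \<in> \<U>" "x \<in> U" using assms(1) by blast
    then have "C = U" using * C \<open>x \<in> C\<close> components_eq by blast
    with \<open>U \<in> \<U>\<close> show "C \<in> \<U>" by simp
  qed
  ultimately show ?thesis by blast
qed

text \<open>Both points lie on the same side of the Jordan curve and in the same component of \<open>- K\<close>, so
  neither set separates them; as the two sets meet in a connected set, Janiszewski's theorem shows
  that their union does not separate them either.\<close>

lemma component_inter_jordan_side:
  fixes K C R F :: "complex set"
  assumes "compact K" "compact C" "connected (C \<inter> K)"
    and F: "F \<in> components (- K)" "C - K \<subseteq> F" "C - K \<noteq> {}"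
    and R: "open R" "connected R" "R \<inter> C = {}" "frontier R = C"
  shows "open (F \<inter> R)" "connected (F \<inter> R)" "F \<inter> R \<noteq> {}" "C - K \<subseteq> frontier (F \<inter> R)"
proof -
  have opF: "open F" using F(1) assms(1) open_components compact_imp_closed open_Compl by metis
  show "open (F \<inter> R)" using opF R(1) by blast
  \<comment> \<open>Every point of \<open>C - K\<close> is a limit of \<open>R\<close> and lies in
    the open set \<open>F\<close>, so it is a limit of \<open>F \<inter> R\<close>.\<close>
  have cl: "C - K \<subseteq> closure (F \<inter> R)"
    using open_Int_closure_subset[OF opF, of R] F(2) R(4) by (auto simp: frontier_def)
  then show "F \<inter> R \<noteq> {}" using F(3) by auto
  show "C - K \<subseteq> frontier (F \<inter> R)"
    using cl R(3) interior_subset[of "F \<inter> R"] by (auto simp: frontier_def)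
  show "connected (F \<inter> R)"
    unfolding connected_iff_connected_component
  proof (intro ballI)
    fix a b assume ab: "a \<in> F \<inter> R" "b \<in> F \<inter> R"
    have "connected_component (- C) a b"
      using ab R by (auto simp: connected_component_def)
    moreover have "connected_component (- K) a b"
      using ab F(1) in_components_connected in_components_subset
      by (fastforce simp: connected_component_def)
    ultimately have "connected_component (- (C \<union> K)) a b"
      using assms by (intro Janiszewski) (auto simp: compact_imp_closed)
    then obtain X where X: "connected X" "X \<subseteq> - (C \<union> K)" "a \<in> X" "b \<in> X"
      by (auto simp: connected_component_def)
    have "X \<subseteq> F"
      using components_maximal[OF F(1) X(1)] X ab by blast
    \<comment> \<open>\<open>X\<close> meets \<open>R\<close> and avoids its frontier
      \<open>C\<close>, so it cannot leave \<open>R\<close>.\<close>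
    moreover have "X \<subseteq> R"
      using connected_Int_frontier[OF X(1), of R] X ab R(4) by blast
    ultimately show "connected_component (F \<inter> R) a b"
      using X by (auto simp: connected_component_def)
  qed
qed

text \<open>Components other than \<open>F\<close> avoid both \<open>F\<close> and \<open>C\<close>,
  so only \<open>F\<close> is cut, and each side of the curve meets it in a connected set by the
  preceding lemma. In the application \<open>K\<close> is a drawing and \<open>C - K\<close> the
  interior of one new edge.\<close>

lemma jordan_curve_splits_component:
  fixes K F :: "complex set" and c :: "real \<Rightarrow> complex"
  defines "C \<equiv> path_image c"
  assumes K: "compact K" and c: "simple_path c" "pathfinish c = pathstart c"
    and CK: "connected (C \<inter> K)"
    and F: "F \<in> components (- K)" "C - K \<subseteq> F" "C - K \<noteq> {}"
  shows "components (- (K \<union> C)) = (components (- K) - {F}) \<union> {F \<inter> inside C, F \<inter> outside C}"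
    and "C - K \<subseteq> frontier (F \<inter> inside C)" "C - K \<subseteq> frontier (F \<inter> outside C)"
    and "F \<inter> inside C \<noteq> {}" "F \<inter> outside C \<noteq> {}"
    and "inside C \<inter> outside C = {}"
proof -
  have J: "open (inside C)" "connected (inside C)" "open (outside C)" "connected (outside C)"
    "inside C \<inter> outside C = {}" "inside C \<union> outside C = - C" "frontier (inside C) = C"
    "frontier (outside C) = C"
    using Jordan_inside_outside[OF c] by (auto simp: C_def)
  have "compact C" using c by (simp add: C_def compact_simple_path_image)
  note side = component_inter_jordan_side[OF K this CK F]
  note i = side[OF J(1,2) inside_no_overlap J(7)] and o = side[OF J(3,4) outside_no_overlap J(8)]
  have opc: "open G" if "G \<in> components (- K)" for G
    using that K open_components compact_imp_closed open_Compl by metis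
  have away: "G \<inter> F = {}" "G \<inter> C = {}" if "G \<in> components (- K) - {F}" for G
  proof -
    show "G \<inter> F = {}" using that F(1) components_nonoverlap by blast
    then show "G \<inter> C = {}" using that F(2) in_components_subset by blast
  qed
  show "components (- (K \<union> C)) = (components (- K) - {F}) \<union> {F \<inter> inside C, F \<inter> outside C}"
  proof (rule components_eq_partition)
    have *: "(X \<union> F) - C = X \<union> F \<inter> (inside C \<union> outside C)" if "X \<inter> C = {}" for X
      unfolding J(6) using that by blast
    have "\<Union> (\<G> \<union> {F \<inter> R, F \<inter> R'}) = \<Union>\<G> \<union> F \<inter> (R \<union> R')" for \<G> R R'
      by blast
    then have "\<Union> ((components (- K) - {F}) \<union> {F \<inter> inside C, F \<inter> outside C})
        = \<Union>(components (- K) - {F}) \<union> F \<inter> (inside C \<union> outside C)" .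
    also have "\<dots> = (\<Union>(components (- K) - {F}) \<union> F) - C"
      by (rule *[symmetric]) (use away(2) in blast)
    also have "\<Union>(components (- K) - {F}) \<union> F = \<Union>(components (- K))"
      using F(1) by blast
    finally show "\<Union> ((components (- K) - {F}) \<union> {F \<inter> inside C, F \<inter> outside C}) = - (K \<union> C)"
      unfolding Union_components by blast
    have d: "A \<inter> B = {}" if "A \<in> components (- K) - {F}"
      "B \<in> components (- K) - {F}" "A \<noteq> B" for A B
      using that components_nonoverlap by blast
    have "disjoint (\<G> \<union> {F \<inter> R, F \<inter> R'})"
      if "\<And>A B. A \<in> \<G> \<Longrightarrow> B \<in> \<G> \<Longrightarrow> A \<noteq> B \<Longrightarrow> A \<inter> B = {}" "\<And>G. G \<in> \<G> \<Longrightarrow> G \<inter> F = {}"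
        "R \<inter> R' = {}" for \<G> R R'
      using that unfolding disjoint_def by blast
    from this[OF d away(1) J(5)]
    show "disjoint ((components (- K) - {F}) \<union> {F \<inter> inside C, F \<inter> outside C})" .
  next
    fix U assume "U \<in> (components (- K) - {F}) \<union> {F \<inter> inside C, F \<inter> outside C}"
    then consider "U \<in> components (- K)" | "U = F \<inter> inside C" | "U = F \<inter> outside C" by blast
    then show "open U \<and> connected U \<and> U \<noteq> {}"
    proof cases
      case 1
      then show ?thesis
        using opc in_components_connected in_components_nonempty by blast
    qed (use i(1-3) o(1-3) in simp_all)
  qed
  show "C - K \<subseteq> frontier (F \<inter> inside C)" "C - K \<subseteq> frontier (F \<inter> outside C)"
    "F \<inter> inside C \<noteq> {}" "F \<inter> outside C \<noteq> {}" "inside C \<inter> outside C = {}"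
    by (rule i(4) o(4) i(3) o(3) J(5))+
qed

text \<open>Janiszewski's theorem applies twice, since the arc meets \<open>K\<^sub>1\<close> in one
  point, and \<open>K\<^sub>1\<close> together with the arc meets \<open>K\<^sub>2\<close> in one
  point; an arc alone does not separate the plane. So \<open>F\<close> minus the arc stays
  connected. The inclusion suffices for bridges, where only upper bounds are needed.\<close>

lemma arc_between_compacts_keeps_component:
  fixes K\<^sub>1 K\<^sub>2 F :: "complex set" and g :: "real \<Rightarrow> complex"
  assumes K: "compact K\<^sub>1" "compact K\<^sub>2" "K\<^sub>1 \<inter> K\<^sub>2 = {}"
    and g: "arc g" "path_image g \<inter> K\<^sub>1 = {pathstart g}" "path_image g \<inter> K\<^sub>2 = {pathfinish g}"
    and F: "F \<in> components (- (K\<^sub>1 \<union> K\<^sub>2))" "path_image g - (K\<^sub>1 \<union> K\<^sub>2) \<subseteq> F"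
  shows "components (- (K\<^sub>1 \<union> K\<^sub>2 \<union> path_image g))
    \<subseteq> (components (- (K\<^sub>1 \<union> K\<^sub>2)) - {F}) \<union> {F - path_image g}"
proof -
  let ?e = "path_image g"
  have Fs: "F \<subseteq> - (K\<^sub>1 \<union> K\<^sub>2)" "connected F"
    using F(1) in_components_subset in_components_connected by auto
  have ce: "connected (- ?e)"
    using connected_arc_complement[OF g(1)] by simp
  have conn: "connected (F - ?e)"
    unfolding connected_iff_connected_component
  proof (intro ballI)
    fix a b assume ab: "a \<in> F - ?e" "b \<in> F - ?e"
    have *: "connected_component (- K\<^sub>1) a b" "connected_component (- K\<^sub>2) a b"
      "connected_component (- ?e) a b"
      using ab Fs ce unfolding connected_component_def by blast+
    have "connected (K\<^sub>1 \<inter> ?e)" "connected ((K\<^sub>1 \<union> ?e) \<inter> K\<^sub>2)"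
      using g(2,3) K(3) by (simp_all add: Int_commute[of K\<^sub>1] Int_Un_distrib2)
    then have "connected_component (- ((K\<^sub>1 \<union> ?e) \<union> K\<^sub>2)) a b"
      using K g(1) *
      by (metis Janiszewski compact_Un compact_arc_image compact_imp_closed)
    then obtain X where X: "connected X" "X \<subseteq> - (K\<^sub>1 \<union> ?e \<union> K\<^sub>2)" "a \<in> X" "b \<in> X"
      by (auto simp: connected_component_def)
    have "X \<subseteq> F"
      using components_maximal[OF F(1) X(1)] X ab by blast
    then show "connected_component (F - ?e) a b"
      using X by (auto simp: connected_component_def)
  qed
  show ?thesis
  proof
    fix U assume U: "U \<in> components (- (K\<^sub>1 \<union> K\<^sub>2 \<union> ?e))"
    have Us: "U \<subseteq> - (K\<^sub>1 \<union> K\<^sub>2 \<union> ?e)" "connected U" "U \<noteq> {}"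
      using in_components_subset[OF U] in_components_connected[OF U] in_components_nonempty[OF U]
      by auto
    then obtain G where G: "G \<in> components (- (K\<^sub>1 \<union> K\<^sub>2))" "U \<subseteq> G"
      using exists_component_superset[of U "- (K\<^sub>1 \<union> K\<^sub>2)"] by blast
    show "U \<in> (components (- (K\<^sub>1 \<union> K\<^sub>2)) - {F}) \<union> {F - ?e}"
    proof (cases "G = F")
      case True
      have "F - ?e \<subseteq> U"
        using components_maximal[OF U conn] Fs Us G True by blast
      then have "U = F - ?e" using Us G True by blast
      then show ?thesis by simp
    next
      case False
      then have "G \<inter> F = {}" using G F components_nonoverlap by blast
      then have "G \<subseteq> - (K\<^sub>1 \<union> K\<^sub>2 \<union> ?e)" using F(2) in_components_subset[OF G(1)] by blast
      then have "G \<subseteq> U"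
        using components_maximal[OF U in_components_connected[OF G(1)]] Us G by blast
      then have "U = G" using G by blast
      then show ?thesis using G False by simp
    qed
  qed
qed

section \<open>Walks and their cycles\<close>

text \<open>The list keeps multiplicities, and a closed walk must repeat its first vertex at the end
  for its closing edge to appear.\<close>

fun walk_edges :: "('a \<Rightarrow> 'a \<Rightarrow> 'b) \<Rightarrow> 'a list \<Rightarrow> 'b list" where
  "walk_edges f (x # y # zs) = f x y # walk_edges f (y # zs)"
| "walk_edges f _ = []"

lemma length_walk_edges: "length (walk_edges f xs) = length xs - 1"
  by (induction f xs rule: walk_edges.induct) auto

lemma walk_edges_append:
  "walk_edges f (xs @ y # zs) = walk_edges f (xs @ [y]) @ walk_edges f (y # zs)"
proof (induction xs)
  case (Cons x xs)
  then show ?case by (cases xs) auto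
qed simp

lemma walk_edges_snoc:
  "xs \<noteq> [] \<Longrightarrow> walk_edges f (xs @ [y]) = walk_edges f xs @ [f (last xs) y]"
  by (cases xs rule: rev_cases) (use walk_edges_append[of f _ _ "[y]"] in auto)

lemma in_walk_edges_split:
  "e \<in> set (walk_edges f xs) \<Longrightarrow> \<exists>ps u v qs. xs = ps @ u # v # qs \<and> e = f u v"
proof (induction f xs rule: walk_edges.induct)
  case (1 f x y zs)
  show ?case
  proof (cases "e = f x y")
    case True
    then show ?thesis by (intro exI[of _ "[]"]) auto
  next
    case False
    then obtain ps u v qs where "y # zs = ps @ u # v # qs" "e = f u v" using 1 by auto
    then show ?thesis by (intro exI[of _ "x # ps"]) auto
  qed
qed auto

text \<open>A closed walk that revisits a vertex is cut there into two shorter closed walks, and the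
  parities add. Without such a vertex it is trivial, runs along one edge and back, or is a simple
  cycle.\<close>

lemma closed_walk_cycle_decomposition:
  assumes "\<And>x y. f x y = f y x" "\<And>x. \<not> R x x"
    and "successively R xs" "xs \<noteq> []" "hd xs = last xs"
  shows "\<exists>Cs. (\<forall>ys\<in>set Cs. distinct ys \<and> 3 \<le> length ys \<and> successively R (ys @ [hd ys]) \<and>
      set (walk_edges f (ys @ [hd ys])) \<subseteq> set (walk_edges f xs)) \<and>
    (\<forall>e. even (count_list (walk_edges f xs) e) =
      even (\<Sum>ys\<leftarrow>Cs. count_list (walk_edges f (ys @ [hd ys])) e))"
  using assms(3-)
proof (induction xs rule: length_induct)
  case (1 xs)
  let ?ok = "\<lambda>Cs xs. (\<forall>ys\<in>set Cs. distinct ys \<and> 3 \<le> length ys \<and> successively R (ys @ [hd ys]) \<and>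
      set (walk_edges f (ys @ [hd ys])) \<subseteq> set (walk_edges f xs)) \<and>
    (\<forall>e. even (count_list (walk_edges f xs) e) =
      even (\<Sum>ys\<leftarrow>Cs. count_list (walk_edges f (ys @ [hd ys])) e))"
  show ?case
  proof (cases "distinct (butlast xs)")
    case True
    obtain zs l where xs: "xs = zs @ [l]" using 1 by (metis append_butlast_last_id)
    consider "zs = []" | a where "zs = [a]" | a b where "zs = [a, b]" | "3 \<le> length zs"
    proof (cases zs)
      case (Cons a zs')
      then show ?thesis using that by (cases zs'; cases "tl zs'") auto
    qed (use that in simp)
    then show ?thesis
    proof cases
      case 1
      then show ?thesis using xs by (intro exI[of _ "[]"]) simp
    next
      case (2 a)
      then show ?thesis using xs "1.prems" assms(2) by simp
    next
      case (3 a b)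
      then have "xs = [a, b, a]" using xs "1.prems" by simp
      \<comment> \<open>One edge traversed twice has even count, so the empty list of cycles has the
        right parities.\<close>
      then show ?thesis using assms(1)[of a b] by (intro exI[of _ "[]"]) simp
    next
      case 4
      then have "hd zs = l" using xs "1.prems" by (cases zs) auto
      then show ?thesis using xs "1.prems" True 4 by (intro exI[of _ "[zs]"]) simp
    qed
  next
    case False
    \<comment> \<open>\<open>butlast\<close> drops the final return, so \<open>y\<close> is a
      genuine repetition. Below, \<open>A\<close> is the closed walk between two visits to
      \<open>y\<close>, and \<open>B\<close> is what remains after \<open>A\<close> is cut
      out.\<close>
    then obtain p q r y where *: "butlast xs = p @ [y] @ q @ [y] @ r"
      using not_distinct_decomp by blast
    then have xs: "xs = p @ y # q @ y # r @ [last xs]"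
      using "1.prems"(2) by (metis append.assoc append_Cons append_Nil append_butlast_last_id)
    define l where "l = last xs"
    define A where "A = y # q @ [y]"
    define B where "B = p @ y # r @ [l]"
    have xs': "xs = p @ y # q @ y # r @ [l]" using xs by (simp add: l_def)
    have we: "walk_edges f xs =
        walk_edges f (p @ [y]) @ walk_edges f A @ walk_edges f (y # r @ [l])"
      using walk_edges_append[of f p y "q @ y # r @ [l]"]
        walk_edges_append[of f "y # q" y "r @ [l]"] by (simp add: xs' A_def)
    have weB: "walk_edges f B = walk_edges f (p @ [y]) @ walk_edges f (y # r @ [l])"
      using walk_edges_append[of f p y "r @ [l]"] by (simp add: B_def)
    have "successively R A" "successively R B"
      using "1.prems"(1) unfolding xs' A_def B_def
      by (auto simp: successively_append_iff successively_Cons hd_append split: if_splits)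
    moreover have "hd B = last B"
      using "1.prems"(3) unfolding xs' B_def by (cases p) auto
    ultimately obtain Cs Ds where "?ok Cs A" "?ok Ds B"
      using "1.IH"[rule_format, of A] "1.IH"[rule_format, of B]
      by (auto simp: A_def B_def xs')
    then have "?ok (Cs @ Ds) xs"
      by (auto simp: we weB)
    then show ?thesis by blast
  qed
qed

text \<open>If the next vertex already lies on the path, the path is cut back to it instead of being
  extended.\<close>

lemma rtranclp_imp_distinct_path:
  assumes "R\<^sup>*\<^sup>* x y"
  shows "\<exists>xs. xs \<noteq> [] \<and> distinct xs \<and> hd xs = x \<and> last xs = y \<and> successively R xs"
  using assms
proof (induction rule: rtranclp_induct)
  case base
  then show ?case by (intro exI[of _ "[x]"]) simp
next
  case (step y z)
  then obtain xs where xs: "xs \<noteq> []" "distinct xs" "hd xs = x" "last xs = y" "successively R xs"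
    by blast
  show ?case
  proof (cases "z \<in> set xs")
    case True
    then obtain p q where "xs = p @ z # q" by (meson split_list)
    then show ?thesis using xs
      by (intro exI[of _ "p @ [z]"])
        (auto simp: successively_append_iff successively_Cons hd_append split: if_splits)
  next
    case False
    then show ?thesis using xs step
      by (intro exI[of _ "xs @ [z]"]) (auto simp: successively_append_iff)
  qed
qed

section \<open>Edges, paths and cycles of a plane graph as point sets\<close>

context plane_graph
begin

text \<open>Unique by \<open>no_parallel\<close>, and meaningful only for adjacent vertices.\<close>

definition edge_between :: "complex \<Rightarrow> complex \<Rightarrow> complex set" where
  "edge_between u v = (THE e. e \<in> E \<and> e \<inter> V = {u, v})"

abbreviation we :: "complex list \<Rightarrow> complex set list" where
  "we \<equiv> walk_edges edge_between"

text \<open>All of \<open>V\<close> is kept for every edge set, so vertices that the edges in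
  \<open>S\<close> miss remain as isolated points of the drawing.\<close>

definition drawing :: "complex set set \<Rightarrow> complex set" where
  "drawing S = V \<union> \<Union>S"

definition cycle :: "complex set set \<Rightarrow> complex list \<Rightarrow> bool" where
  "cycle S ys \<longleftrightarrow> distinct ys \<and> 3 \<le> length ys \<and> successively (adjacent V S) (ys @ [hd ys])"

abbreviation cycle_edges :: "complex list \<Rightarrow> complex set set" where
  "cycle_edges ys \<equiv> set (we (ys @ [hd ys]))"

lemma edge_ends:
  assumes "e \<in> E"
  obtains u v where "u \<noteq> v" "e \<inter> V = {u, v}"
  using edge_arc[OF assms] arc_distinct_ends by metis

lemma edge_between_eq:
  assumes "e \<in> E" "e \<inter> V = {u, v}"
  shows "edge_between u v = e"
  unfolding edge_between_def using assms no_parallel by (intro the_equality) auto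

lemma edge_between_commute: "edge_between u v = edge_between v u"
  by (simp add: edge_between_def insert_commute)

lemma adjacent_edge_between:
  assumes "S \<subseteq> E" "adjacent V S u v"
  shows "edge_between u v \<in> S" "edge_between u v \<inter> V = {u, v}"
proof -
  obtain e where "e \<in> S" "e \<inter> V = {u, v}" using assms(2) unfolding adjacent_def by blast
  moreover then have "edge_between u v = e" using assms(1) edge_between_eq by blast
  ultimately show "edge_between u v \<in> S" "edge_between u v \<inter> V = {u, v}" by simp_all
qed

lemma adjacent_irrefl: "S \<subseteq> E \<Longrightarrow> \<not> adjacent V S v v"
  unfolding adjacent_def by (metis edge_ends doubleton_eq_iff insert_absorb2 subsetD)

lemma adjacent_mono: "adjacent V S u v \<Longrightarrow> S \<subseteq> S' \<Longrightarrow> adjacent V S' u v"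
  unfolding adjacent_def by blast

lemma edge_arc_between:
  assumes "e \<in> E" "e \<inter> V = {u, v}"
  obtains g where "arc g" "path_image g = e" "pathstart g = u" "pathfinish g = v"
proof -
  obtain g where g: "arc g" "path_image g = e" "e \<inter> V = {pathstart g, pathfinish g}"
    using edge_arc[OF assms(1)] by blast
  then consider "pathstart g = u" "pathfinish g = v" | "pathstart g = v" "pathfinish g = u"
    using assms(2) by (metis doubleton_eq_iff)
  then show thesis
  proof cases
    case 2
    then show thesis using that[of "reversepath g"] g by (simp add: arc_reversepath)
  qed (use that g in blast)
qed

lemma edge_compact: "e \<in> E \<Longrightarrow> compact e"
  using edge_arc compact_arc_image by blast

lemma compact_drawing: "S \<subseteq> E \<Longrightarrow> compact (drawing S)"
  unfolding drawing_def using finite_V finite_E edge_compact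
  by (intro compact_Un[OF finite_imp_compact] compact_Union) (auto intro: finite_subset)

text \<open>The ends of an arc are limits of its inner points. Thus a closed set that contains
  \<open>e - V\<close>, such as a frontier, contains \<open>e\<close>.\<close>

lemma edge_interior:
  assumes "e \<in> E"
  shows "connected (e - V)" "e - V \<noteq> {}" "e \<subseteq> closure (e - V)"
proof -
  obtain g where g: "arc g" "path_image g = e" "e \<inter> V = {pathstart g, pathfinish g}"
    using edge_arc[OF assms] by blast
  then have eq: "e - V = path_image g - {pathstart g, pathfinish g}" by auto
  have sp: "simple_path g" using g(1) by (rule arc_imp_simple_path)
  show "connected (e - V)" "e - V \<noteq> {}"
    unfolding eq using sp connected_simple_path_endless nonempty_simple_path_endless by blast+
  have "closure {0<..<1::real} = {0..1}" by simp
  moreover have "continuous_on {0..1} g" using g(1) by (simp add: arc_def path_def)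
  ultimately have "g ` {0..1} \<subseteq> closure (g ` {0<..<1})"
    by (metis closed_closure closure_subset image_closure_subset)
  then show "e \<subseteq> closure (e - V)"
    unfolding eq simple_path_endless[OF sp] using g(2) by (simp add: path_image_def)
qed

lemma edge_inter_drawing:
  assumes "e \<in> E" "S \<subseteq> E" "e \<notin> S"
  shows "e \<inter> drawing S = e \<inter> V" "e - drawing S = e - V"
proof -
  have "e \<inter> \<Union>S \<subseteq> V" using edges_meet_at_vertices[OF assms(1)] assms(2,3) by blast
  then show "e \<inter> drawing S = e \<inter> V" "e - drawing S = e - V" unfolding drawing_def by blast+
qed

lemma drawing_insert: "drawing (insert e S) = drawing S \<union> e"
  unfolding drawing_def by auto

lemma drawing_mono: "S \<subseteq> S' \<Longrightarrow> drawing S \<subseteq> drawing S'"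
  unfolding drawing_def by blast

lemma we_subset:
  assumes "S \<subseteq> E" "successively (adjacent V S) xs"
  shows "set (we xs) \<subseteq> S"
  using assms(2)
proof (induction xs rule: induct_list012)
  case (3 x y zs)
  then show ?case using adjacent_edge_between[OF assms(1)] by auto
qed auto

lemma we_ends:
  assumes "successively (adjacent V E) xs" "e \<in> set (we xs)"
  shows "e \<in> E" "e \<inter> V \<subseteq> set xs"
proof -
  show "e \<in> E" using we_subset[OF order_refl assms(1)] assms(2) by blast
  obtain ps u v qs where *: "xs = ps @ u # v # qs" "e = edge_between u v"
    using in_walk_edges_split[OF assms(2)] by blast
  then have "adjacent V E u v"
    using assms(1) by (auto simp: successively_append_iff)
  then show "e \<inter> V \<subseteq> set xs" using adjacent_edge_between[of E] * by auto
qed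

text \<open>The first edge contains \<open>x\<close>, while the later edges have their ends among
  the later vertices.\<close>

lemma distinct_we:
  assumes "distinct xs" "successively (adjacent V E) xs"
  shows "distinct (we xs)"
  using assms
proof (induction xs rule: induct_list012)
  case (3 x y zs)
  then have "edge_between x y \<inter> V = {x, y}" using adjacent_edge_between[of E] by auto
  moreover have "\<And>e. e \<in> set (we (y # zs)) \<Longrightarrow> e \<inter> V \<subseteq> set (y # zs)"
    by (rule we_ends(2)) (use 3 in simp_all)
  ultimately have "edge_between x y \<notin> set (we (y # zs))" using 3(3) by auto
  then show ?case using 3 by auto
qed auto

text \<open>Distinct edges meet only in vertices, so the first edge meets the rest of the path only
  in \<open>y\<close>, and the arcs can be joined.\<close>

lemma path_arc:
  assumes "distinct xs" "successively (adjacent V E) xs" "2 \<le> length xs"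
  shows "\<exists>g. arc g \<and> pathstart g = hd xs \<and> pathfinish g = last xs \<and> path_image g = \<Union>(set (we xs))"
  using assms
proof (induction xs rule: induct_list012)
  case (3 x y zs)
  have e: "edge_between x y \<in> E" "edge_between x y \<inter> V = {x, y}"
    using 3 adjacent_edge_between[of E] by auto
  obtain g where g: "arc g" "path_image g = edge_between x y" "pathstart g = x" "pathfinish g = y"
    using edge_arc_between[OF e] .
  show ?case
  proof (cases zs)
    case Nil
    then show ?thesis using g by auto
  next
    case (Cons z ws)
    then obtain h where h: "arc h" "pathstart h = y" "pathfinish h = last (y # zs)"
      "path_image h = \<Union>(set (we (y # zs)))"
      using 3 by auto
    have "edge_between x y \<inter> e \<subseteq> {y}" if "e \<in> set (we (y # zs))" for e
    proof -
      have "successively (adjacent V E) (y # zs)" using 3 by simp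
      then have *: "e \<in> E" "e \<inter> V \<subseteq> set (y # zs)" using we_ends that by blast+
      have "e \<noteq> edge_between x y" using distinct_we[of "x # y # zs"] 3 that by auto
      then have "edge_between x y \<inter> e \<subseteq> V" using edges_meet_at_vertices e * by blast
      then show ?thesis using e(2) *(2) 3(3) by auto
    qed
    then have "path_image g \<inter> path_image h \<subseteq> {pathstart h}"
      using g h by auto
    then have "arc (g +++ h)" using g h by (intro arc_join) auto
    then show ?thesis using g h by (intro exI[of _ "g +++ h"]) (auto simp: path_image_join)
  qed
qed auto

text \<open>The cycle has a third vertex, so its closing edge differs from the first edge; the later
  edges of the path miss the first vertex altogether.\<close>

lemma closing_edge:
  assumes "cycle E ys"
  shows "edge_between (last ys) (hd ys) \<in> E" "edge_between (last ys) (hd ys) \<inter> V = {last ys, hd ys}"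
    "edge_between (last ys) (hd ys) \<notin> set (we ys)" "last ys \<noteq> hd ys"
    "cycle_edges ys = insert (edge_between (last ys) (hd ys)) (set (we ys))"
    "distinct (we (ys @ [hd ys]))"
proof -
  obtain x y z zs where ys: "ys = x # y # z # zs"
    using assms unfolding cycle_def
    by (metis One_nat_def Suc_le_length_iff numeral_3_eq_3)
  let ?e = "edge_between (last ys) (hd ys)"
  have s: "successively (adjacent V E) ys" "adjacent V E (last ys) (hd ys)" and d: "distinct ys"
    using assms ys successively_append_iff[of "adjacent V E" ys "[hd ys]"] unfolding cycle_def
    by simp_all
  show e: "?e \<in> E" "?e \<inter> V = {last ys, hd ys}" using adjacent_edge_between[OF order_refl s(2)] by simp_all
  show "last ys \<noteq> hd ys" using d ys by auto
  have 1: "edge_between x y \<inter> V = {x, y}" using s ys adjacent_edge_between[of E] by auto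
  have 2: "last ys \<noteq> y" "last ys \<noteq> x" "hd ys = x" "last ys = last (z # zs)" using d ys by auto
  then have "?e \<noteq> edge_between x y" using e(2) 1 by auto
  moreover have "?e \<notin> set (we (y # z # zs))"
    using we_ends(2)[of "y # z # zs" ?e] s d ys e(2) by auto
  ultimately show ne: "?e \<notin> set (we ys)" using ys by simp
  have "we (ys @ [hd ys]) = we ys @ [?e]" using ys by (intro walk_edges_snoc) simp
  then show "cycle_edges ys = insert ?e (set (we ys))" "distinct (we (ys @ [hd ys]))"
    using ne distinct_we[OF d s(1)] by auto
qed

lemma cycle_edges_subset: "cycle S ys \<Longrightarrow> S \<subseteq> E \<Longrightarrow> cycle_edges ys \<subseteq> S"
  unfolding cycle_def using we_subset by blast

lemma cycle_mono: "cycle S ys \<Longrightarrow> S \<subseteq> S' \<Longrightarrow> cycle S' ys"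
  unfolding cycle_def using adjacent_mono by (blast intro: successively_mono)

lemma card_cycle_edges: "cycle E ys \<Longrightarrow> card (cycle_edges ys) = length ys"
  using distinct_card[OF closing_edge(6)] by (simp add: length_walk_edges)

text \<open>The path without the closing edge is an arc, and the closing edge meets it only at its
  two ends.\<close>

lemma cycle_jordan_curve:
  assumes "cycle E ys"
  obtains c where "simple_path c" "pathfinish c = pathstart c" "path_image c = \<Union>(cycle_edges ys)"
proof -
  note cl = closing_edge[OF assms]
  have s: "successively (adjacent V E) ys" "distinct ys" "3 \<le> length ys"
    using assms unfolding cycle_def by (auto simp: successively_append_iff)
  obtain g where g: "arc g" "pathstart g = hd ys" "pathfinish g = last ys"
    "path_image g = \<Union>(set (we ys))"
    using path_arc s by force
  obtain h where h: "arc h" "path_image h = edge_between (last ys) (hd ys)" "pathstart h = last ys"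
    "pathfinish h = hd ys"
    using edge_arc_between[OF cl(1,2)] .
  have "edge_between (last ys) (hd ys) \<inter> e \<subseteq> {last ys, hd ys}" if "e \<in> set (we ys)" for e
  proof -
    have "e \<in> E" using we_ends(1)[OF s(1) that] .
    then have "edge_between (last ys) (hd ys) \<inter> e \<subseteq> V"
      using edges_meet_at_vertices cl(1,3) that by blast
    then show ?thesis using cl(2) by blast
  qed
  then have "path_image g \<inter> path_image h \<subseteq> {pathstart g, pathstart h}"
    using g h by auto
  then have "simple_path (g +++ h)" using g h by (intro simple_path_join_loop) auto
  then show thesis using g h cl(5) by (intro that[of "g +++ h"]) (auto simp: path_image_join)
qed

text \<open>Rotate the cycle until the edge becomes its closing edge.\<close>

lemma connected_cycle_minus_edge:
  assumes "cycle E ys" "e \<in> cycle_edges ys"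
  shows "connected (\<Union>(cycle_edges ys - {e}))"
    and "e \<inter> V \<subseteq> \<Union>(cycle_edges ys - {e})"
proof -
  obtain zs where zs: "cycle E zs" "cycle_edges zs = cycle_edges ys" "e = edge_between (last zs) (hd zs)"
  proof -
    obtain ps u v qs where *: "ys @ [hd ys] = ps @ u # v # qs" "e = edge_between u v"
      using in_walk_edges_split[OF assms(2)] by blast
    show thesis
    proof (cases qs rule: rev_cases)
      case Nil
      then have "ys = ps @ [u]" "hd ys = v" using * by auto
      then show thesis using that[of ys] assms * by simp
    next
      case (snoc qs' a)
      then have ys: "ys = ps @ u # v # qs'" "a = hd ys" using * by auto
      \<comment> \<open>The same cycle started at \<open>v\<close>, so that it ends at
        \<open>u\<close> and closes through \<open>e\<close>.\<close>
      define zs where "zs = v # qs' @ ps @ [u]"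
      have cyc: "successively (adjacent V E) (ys @ [hd ys])" "distinct ys" "3 \<le> length ys"
        using assms(1) unfolding cycle_def by auto
      have "cycle E zs"
        using cyc unfolding cycle_def zs_def ys
        by (cases ps; cases qs')
          (auto simp: successively_append_iff successively_Cons hd_append split: if_splits)
      moreover have "cycle_edges zs = cycle_edges ys"
      proof (cases ps)
        case Nil
        then show ?thesis
          using walk_edges_append[of edge_between "v # qs'" u "[v]"] by (auto simp: ys zs_def)
      next
        case (Cons b ps')
        then have "we (ys @ [hd ys]) = we (ps @ [u]) @ [edge_between u v] @ we (v # qs' @ [b])"
          using walk_edges_append[of edge_between ps u "v # qs' @ [b]"] by (simp add: ys)
        moreover have "we (zs @ [hd zs]) = we (v # qs' @ [b]) @ we (ps @ [u]) @ [edge_between u v]"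
          using walk_edges_append[of edge_between "v # qs'" b "ps' @ [u, v]"]
            walk_edges_append[of edge_between ps u "[v]"] Cons by (simp add: zs_def)
        ultimately show ?thesis by auto
      qed
      ultimately show thesis using that[of zs] * by (simp add: zs_def)
    qed
  qed
  note cl = closing_edge[OF zs(1)]
  have s: "successively (adjacent V E) zs" "distinct zs" "3 \<le> length zs"
    using zs(1) unfolding cycle_def by (auto simp: successively_append_iff)
  obtain g where g: "arc g" "pathstart g = hd zs" "pathfinish g = last zs"
    "path_image g = \<Union>(set (we zs))"
    using path_arc s by force
  have eq: "cycle_edges ys - {e} = set (we zs)" using zs cl by auto
  show "connected (\<Union>(cycle_edges ys - {e}))"
    unfolding eq g(4)[symmetric] using g(1) by (rule connected_arc_image)
  show "e \<inter> V \<subseteq> \<Union>(cycle_edges ys - {e})"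
  proof -
    have "{last zs, hd zs} \<subseteq> path_image g"
      using g pathstart_in_path_image[of g] pathfinish_in_path_image[of g] by auto
    then show ?thesis using eq g(4) cl(2) zs(3) by simp
  qed
qed

end

section \<open>Faces of plane graphs\<close>

context plane_graph
begin

abbreviation comps :: "complex set set \<Rightarrow> complex set set" where
  "comps S \<equiv> components (- drawing S)"

lemma faces_eq: "faces V E = comps E"
  by (simp add: faces_def drawing_def)

lemma open_comps: "S \<subseteq> E \<Longrightarrow> F \<in> comps S \<Longrightarrow> open F"
  using compact_drawing compact_imp_closed open_Compl open_components by metis

lemma edge_in_comp:
  assumes "e \<in> E" "S \<subseteq> E" "e \<notin> S"
  obtains F where "F \<in> comps S" "e - V \<subseteq> F"
proof -
  have "e - V \<subseteq> - drawing S" using edge_inter_drawing(2)[OF assms] by blast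
  then show thesis
    using that exists_component_superset[of "e - V" "- drawing S"] edge_interior[OF assms(1)] by blast
qed

text \<open>The cycle meets the drawing of \<open>S\<close> exactly in the cycle without the
  interior of \<open>e\<close>. This is connected, so the curve cuts only the face \<open>F\<close>
  that contains the interior of \<open>e\<close>.\<close>

lemma cycle_edge_splits:
  assumes e: "e \<in> E" "S \<subseteq> E" "e \<notin> S"
    and ys: "cycle (insert e S) ys" "e \<in> cycle_edges ys"
    and F: "F \<in> comps S" "e - V \<subseteq> F"
  defines "C \<equiv> \<Union>(cycle_edges ys)"
  shows "comps (insert e S) = (comps S - {F}) \<union> {F \<inter> inside C, F \<inter> outside C}"
    and "e \<subseteq> frontier (F \<inter> inside C)" "e \<subseteq> frontier (F \<inter> outside C)"
    and "F \<inter> inside C \<noteq> {}" "F \<inter> outside C \<noteq> {}" "inside C \<inter> outside C = {}"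
proof -
  have cyc: "cycle E ys" using ys(1) e by (auto intro: cycle_mono)
  obtain c where c: "simple_path c" "pathfinish c = pathstart c" "path_image c = C"
    using cycle_jordan_curve[OF cyc] unfolding C_def .
  define D where "D = \<Union>(cycle_edges ys - {e})"
  have D: "connected D" "e \<inter> V \<subseteq> D"
    unfolding D_def using connected_cycle_minus_edge[OF cyc ys(2)] by auto
  have "cycle_edges ys \<subseteq> insert e S" using cycle_edges_subset[OF ys(1)] e by blast
  then have DK: "D \<subseteq> drawing S" unfolding D_def drawing_def by blast
  have C: "C = e \<union> D" unfolding C_def D_def using ys(2) by blast
  have eK: "e \<inter> drawing S = e \<inter> V" "e - drawing S = e - V" by (rule edge_inter_drawing[OF e])+
  have 1: "C \<inter> drawing S = D" unfolding C using DK eK D(2) by blast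
  have 2: "C - drawing S = e - V" unfolding C using DK eK by blast
  have 3: "drawing S \<union> C = drawing (insert e S)"
    unfolding C drawing_insert using DK by blast
  note split = jordan_curve_splits_component[OF compact_drawing[OF e(2)] c(1,2), unfolded c(3) 1 2 3,
    OF D(1) F edge_interior(2)[OF e(1)]]
  show "comps (insert e S) = (comps S - {F}) \<union> {F \<inter> inside C, F \<inter> outside C}"
    "F \<inter> inside C \<noteq> {}" "F \<inter> outside C \<noteq> {}" "inside C \<inter> outside C = {}"
    by (rule split)+
  show "e \<subseteq> frontier (F \<inter> inside C)"
    using edge_interior(3)[OF e(1)] closure_minimal[OF split(2) frontier_closed] by (rule order_trans)
  show "e \<subseteq> frontier (F \<inter> outside C)"
    using edge_interior(3)[OF e(1)] closure_minimal[OF split(3) frontier_closed] by (rule order_trans)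
qed

text \<open>No edge of \<open>S\<close> leaves \<open>W\<close>, so the drawing falls into two
  disjoint compact parts, one around \<open>W\<close> and one around \<open>V - W\<close>, and
  \<open>e\<close> is an arc between them.\<close>

lemma bridge_keeps_comps:
  assumes e: "e \<in> E" "S \<subseteq> E" "e \<notin> S" "e \<inter> V = {u, v}"
    and W: "W \<subseteq> V" "u \<in> W" "v \<notin> W" "\<And>d. d \<in> S \<Longrightarrow> d \<inter> V \<subseteq> W \<or> d \<inter> W = {}"
    and F: "F \<in> comps S" "e - V \<subseteq> F"
  shows "comps (insert e S) \<subseteq> (comps S - {F}) \<union> {F - e}"
proof -
  define S\<^sub>1 where "S\<^sub>1 = {d \<in> S. d \<inter> V \<subseteq> W}"
  define S\<^sub>2 where "S\<^sub>2 = {d \<in> S. d \<inter> W = {}}"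
  define K\<^sub>1 where "K\<^sub>1 = W \<union> \<Union>S\<^sub>1"
  define K\<^sub>2 where "K\<^sub>2 = (V - W) \<union> \<Union>S\<^sub>2"
  have fin: "finite S\<^sub>1" "finite S\<^sub>2" "finite W" "S\<^sub>1 \<subseteq> E" "S\<^sub>2 \<subseteq> E"
    using finite_subset[OF e(2) finite_E] finite_subset[OF W(1) finite_V] e(2)
    by (auto simp: S\<^sub>1_def S\<^sub>2_def)
  have S12: "S = S\<^sub>1 \<union> S\<^sub>2" using W(4) by (auto simp: S\<^sub>1_def S\<^sub>2_def)
  have un: "K\<^sub>1 \<union> K\<^sub>2 = drawing S" unfolding K\<^sub>1_def K\<^sub>2_def drawing_def S12 using W(1) by blast
  have K: "compact K\<^sub>1" "compact K\<^sub>2"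
    unfolding K\<^sub>1_def K\<^sub>2_def using fin finite_V edge_compact
    by (intro compact_Un[OF finite_imp_compact] compact_Union; blast)+
  have disj: "K\<^sub>1 \<inter> K\<^sub>2 = {}"
  proof -
    have "d \<inter> d' = {}" if d: "d \<in> S\<^sub>1" "d' \<in> S\<^sub>2" for d d'
    proof -
      have "d \<inter> V \<noteq> {}" using edge_ends[of d] d(1) fin(4) by blast
      then have "d \<noteq> d'" using d unfolding S\<^sub>1_def S\<^sub>2_def by blast
      then have "d \<inter> d' \<subseteq> V" using edges_meet_at_vertices d fin by blast
      then show ?thesis using d unfolding S\<^sub>1_def S\<^sub>2_def by blast
    qed
    then show ?thesis using W(1) unfolding K\<^sub>1_def K\<^sub>2_def S\<^sub>1_def S\<^sub>2_def by blast
  qed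
  obtain g where g: "arc g" "path_image g = e" "pathstart g = u" "pathfinish g = v"
    using edge_arc_between[OF e(1,4)] .
  have uv: "u \<in> V" "v \<in> V" using e(4) by auto
  have "e \<inter> (K\<^sub>1 \<union> K\<^sub>2) = {u, v}"
    unfolding un edge_inter_drawing(1)[OF e(1-3)] by (rule e(4))
  moreover have "u \<in> K\<^sub>1" "v \<in> K\<^sub>2" unfolding K\<^sub>1_def K\<^sub>2_def using W uv by auto
  ultimately have "e \<inter> K\<^sub>1 = {u}" "e \<inter> K\<^sub>2 = {v}" using disj by blast+
  then show ?thesis
    using arc_between_compacts_keeps_component[OF K disj g(1), of F] F
      edge_inter_drawing(2)[OF e(1-3)] g
    unfolding un drawing_insert by simp
qed

text \<open>A simple path from \<open>u\<close> to \<open>v\<close> in \<open>S\<close> has at least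
  three vertices because no edge of \<open>S\<close> is parallel to \<open>e\<close>; adding
  \<open>e\<close> closes it to a cycle.\<close>

lemma path_closes_to_cycle:
  assumes e: "e \<in> E" "S \<subseteq> E" "e \<notin> S" "e \<inter> V = {u, v}"
    and path: "(adjacent V S)\<^sup>*\<^sup>* u v"
  obtains ys where "cycle (insert e S) ys" "e \<in> cycle_edges ys"
proof -
  obtain xs where xs: "xs \<noteq> []" "distinct xs" "hd xs = u" "last xs = v" "successively (adjacent V S) xs"
    using rtranclp_imp_distinct_path[OF path] by blast
  have "u \<noteq> v" using e(1,4) by (metis edge_ends doubleton_eq_iff insert_absorb2)
  have nadj: "\<not> adjacent V S u v"
    using no_parallel[OF e(1)] e unfolding adjacent_def by (metis subsetD)
  have "3 \<le> length xs"
  proof (rule ccontr)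
    assume "\<not> 3 \<le> length xs"
    then consider a where "xs = [a]" | a b where "xs = [a, b]"
      using xs(1) by (cases xs; cases "tl xs"; cases "tl (tl xs)") auto
    then show False using xs \<open>u \<noteq> v\<close> nadj by cases auto
  qed
  moreover have "successively (adjacent V (insert e S)) (xs @ [hd xs])"
  proof -
    have "successively (adjacent V (insert e S)) xs"
      using xs(5) by (rule successively_mono) (auto intro: adjacent_mono)
    moreover have "adjacent V (insert e S) v u"
      using e(4) unfolding adjacent_def by auto
    ultimately show ?thesis using xs by (simp add: successively_append_iff)
  qed
  ultimately have cyc: "cycle (insert e S) xs" using xs unfolding cycle_def by blast
  then have "cycle E xs" using e by (auto intro: cycle_mono)
  moreover have "edge_between (last xs) (hd xs) = e"
    using edge_between_eq[of e v u] e xs by (simp add: insert_commute)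
  ultimately have "e \<in> cycle_edges xs" using closing_edge(5) by blast
  with cyc show thesis using that by blast
qed

text \<open>\<open>F\<close> is open and disjoint from every other component, so no other closure
  reaches the interior of \<open>e\<close>. Hence only pieces of \<open>F\<close> can border
  \<open>e\<close> once the edge is put back.\<close>

lemma face_at_edge:
  assumes e: "e \<in> E" and F: "F \<in> comps (E - {e})" "e - V \<subseteq> F"
    and U: "U \<in> comps (E - {e})" "e \<subseteq> frontier U"
  shows "U = F"
proof (rule ccontr)
  assume "U \<noteq> F"
  then have "F \<inter> U = {}" using F(1) U(1) components_nonoverlap by blast
  moreover have "open F" using open_comps F(1) by blast
  ultimately have "F \<inter> closure U = {}" by (simp add: open_Int_closure_eq_empty)
  then show False
    using F(2) U(2) edge_interior(2)[OF e] unfolding frontier_def by blast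
qed

text \<open>\<open>F\<close> belongs to the graph without \<open>e\<close> and does not depend on
  the cycle. Hence all cycles through \<open>e\<close> determine the same pair of faces, which makes
  it possible to compare different cycles.\<close>

lemma faces_at_cycle_edge:
  assumes ys: "cycle E ys" "e \<in> cycle_edges ys" and F: "F \<in> comps (E - {e})" "e - V \<subseteq> F"
  defines "C \<equiv> \<Union>(cycle_edges ys)"
  shows "{U \<in> faces V E. e \<subseteq> frontier U} = {F \<inter> inside C, F \<inter> outside C}"
    and "F \<inter> inside C \<noteq> {}" "F \<inter> outside C \<noteq> {}" "inside C \<inter> outside C = {}"
proof -
  have e: "e \<in> E" using cycle_edges_subset[OF ys(1)] ys(2) by blast
  then have ins: "insert e (E - {e}) = E" by blast
  note split = cycle_edge_splits[OF e _ _ _ ys(2) F, unfolded ins, OF _ _ ys(1), folded C_def]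
  show "F \<inter> inside C \<noteq> {}" "F \<inter> outside C \<noteq> {}" "inside C \<inter> outside C = {}"
    by (rule split; blast)+
  have 1: "comps E = (comps (E - {e}) - {F}) \<union> {F \<inter> inside C, F \<inter> outside C}"
    by (rule split) auto
  have "e \<subseteq> frontier (F \<inter> inside C)" "e \<subseteq> frontier (F \<inter> outside C)"
    by (rule split; blast)+
  then show "{U \<in> faces V E. e \<subseteq> frontier U} = {F \<inter> inside C, F \<inter> outside C}"
    unfolding faces_eq 1 using face_at_edge[OF e F] by blast
qed

text \<open>\<open>W\<close> collects the vertices reachable from \<open>u\<close> without
  \<open>e\<close>. The other end is not among them, as a path to it would close to a cycle, so
  \<open>e\<close> joins two separate parts of the drawing.\<close>

lemma faces_at_bridge:
  assumes e: "e \<in> E" and "\<nexists>ys. cycle E ys \<and> e \<in> cycle_edges ys"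
  obtains F where "{U \<in> faces V E. e \<subseteq> frontier U} \<subseteq> {F}"
proof -
  have ins: "insert e (E - {e}) = E" using e by blast
  obtain u v where uv: "e \<inter> V = {u, v}" using edge_ends[OF e] .
  define W where "W = {w \<in> V. (adjacent V (E - {e}))\<^sup>*\<^sup>* u w}"
  obtain F where F: "F \<in> comps (E - {e})" "e - V \<subseteq> F"
    using edge_in_comp[OF e, of "E - {e}"] by blast
  have "\<not> (adjacent V (E - {e}))\<^sup>*\<^sup>* u v"
  proof
    assume "(adjacent V (E - {e}))\<^sup>*\<^sup>* u v"
    then obtain ys where "cycle E ys" "e \<in> cycle_edges ys"
      using path_closes_to_cycle[OF e _ _ uv, of "E - {e}"] unfolding ins by blast
    then show False using assms(2) by blast
  qed
  then have "v \<notin> W" by (simp add: W_def)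
  moreover have "u \<in> W" using uv by (auto simp: W_def)
  moreover have "d \<inter> V \<subseteq> W \<or> d \<inter> W = {}" if d: "d \<in> E - {e}" for d
  proof -
    obtain a b where ab: "d \<inter> V = {a, b}" using edge_ends d by blast
    then have "adjacent V (E - {e}) a b" "adjacent V (E - {e}) b a"
      using d by (auto simp: adjacent_def)
    then have "a \<in> W \<longleftrightarrow> b \<in> W"
      using ab unfolding W_def by (auto intro: rtranclp.rtrancl_into_rtrancl)
    moreover have "d \<inter> W \<subseteq> {a, b}" using ab by (auto simp: W_def)
    ultimately show ?thesis unfolding ab by (cases "a \<in> W") auto
  qed
  ultimately have "comps E \<subseteq> (comps (E - {e}) - {F}) \<union> {F - e}"
    using bridge_keeps_comps[OF e _ _ uv, of "E - {e}" W F] F unfolding ins by (auto simp: W_def)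
  then have "{U \<in> faces V E. e \<subseteq> frontier U} \<subseteq> {F - e}"
    unfolding faces_eq using face_at_edge[OF e F] by blast
  then show thesis using that by blast
qed

text \<open>Connected subgraphs are grown one edge at a time from a vertex. The end \<open>v\<close>
  may be new, or lie in \<open>W\<close> already, in which case a new edge closes a cycle; these are
  the cases of the face count.\<close>

inductive conn :: "complex set \<Rightarrow> complex set set \<Rightarrow> bool" where
  base: "v \<in> V \<Longrightarrow> conn {v} {}"
| step: "conn W S \<Longrightarrow> e \<in> E \<Longrightarrow> e \<inter> V = {u, v} \<Longrightarrow> u \<in> W \<Longrightarrow> conn (insert v W) (insert e S)"

lemma conn_subset:
  assumes "conn W S"
  shows "W \<subseteq> V" "S \<subseteq> E" "\<And>e. e \<in> S \<Longrightarrow> e \<inter> V \<subseteq> W" "W \<noteq> {}"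
proof -
  have "W \<subseteq> V \<and> S \<subseteq> E \<and> (\<forall>e\<in>S. e \<inter> V \<subseteq> W) \<and> W \<noteq> {}"
    using assms
  proof (induction rule: conn.induct)
    case (step W S e u v)
    have "v \<in> V" using step.hyps(3) by blast
    moreover have "\<forall>d\<in>insert e S. d \<inter> V \<subseteq> insert v W"
      using step.IH step.hyps(3,4) by (simp add: subset_insertI2)
    ultimately show ?case using step.IH step.hyps(2) by simp
  qed simp
  then show "W \<subseteq> V" "S \<subseteq> E" "\<And>e. e \<in> S \<Longrightarrow> e \<inter> V \<subseteq> W" "W \<noteq> {}" by simp_all
qed

lemma conn_finite:
  assumes "conn W S"
  shows "finite W" "finite S"
  using conn_subset[OF assms] finite_V finite_E finite_subset by blast+

lemma conn_reachable:
  assumes "conn W S" "x \<in> W" "y \<in> W"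
  shows "(adjacent V S)\<^sup>*\<^sup>* x y"
  using assms
proof (induction arbitrary: x y rule: conn.induct)
  case (step W S e u v)
  let ?R = "(adjacent V (insert e S))\<^sup>*\<^sup>*"
  have mono: "?R a b" if "a \<in> W" "b \<in> W" for a b
    using step.IH[OF that] by (rule rtranclp_mono[THEN predicate2D, rotated]) (auto intro: adjacent_mono)
  have "adjacent V (insert e S) u v" "adjacent V (insert e S) v u"
    using step.hyps by (auto simp: adjacent_def)
  then have "?R a v" "?R v a" if "a \<in> W" for a
    using mono[OF that \<open>u \<in> W\<close>] mono[OF \<open>u \<in> W\<close> that]
    by (auto intro: rtranclp.rtrancl_into_rtrancl converse_rtranclp_into_rtranclp)
  then show ?case using step.prems mono by auto
qed auto

text \<open>This is the upper half of Euler's formula. The complement of finitely many points has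
  one component; an edge to a new vertex creates none, and a new edge between old vertices replaces
  one component by two.\<close>

lemma card_comps_conn:
  assumes "conn W S"
  shows "finite (comps S) \<and> card (comps S) + card W \<le> card S + 2"
  using assms
proof (induction rule: conn.induct)
  case (base v)
  have "connected (- V)"
    using path_connected_complement_countable[of V] finite_V
    by (simp add: countable_finite path_connected_imp_connected)
  then have "comps {} \<subseteq> {- V}"
    by (simp add: drawing_def connected_eq_components_subset_sing)
  then have "finite (comps {})" "card (comps {}) \<le> 1"
    using finite_subset card_mono[of "{- V}"] by fastforce+
  then show ?case by simp
next
  case (step W S e u v)
  note sub = conn_subset[OF step.hyps(1)] and fin = conn_finite[OF step.hyps(1)]
  show ?case
  proof (cases "e \<in> S")
    case True
    then have "insert v W = W" "insert e S = S" using sub(3)[OF True] step.hyps by auto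
    then show ?thesis using step.IH by simp
  next
    case False
    obtain F where F: "F \<in> comps S" "e - V \<subseteq> F"
      using edge_in_comp[OF step.hyps(2) sub(2) False] .
    have c1: "card (comps S - {F}) + 1 = card (comps S)" "finite (comps S)"
      using F(1) step.IH card_Suc_Diff1[of "comps S" F] by simp_all
    show ?thesis
    proof (cases "v \<in> W")
      case True
      then obtain ys where ys: "cycle (insert e S) ys" "e \<in> cycle_edges ys"
        using path_closes_to_cycle[OF step.hyps(2) sub(2) False step.hyps(3)]
          conn_reachable[OF step.hyps(1) step.hyps(4)] by blast
      have "comps (insert e S) = (comps S - {F}) \<union>
          {F \<inter> inside (\<Union>(cycle_edges ys)), F \<inter> outside (\<Union>(cycle_edges ys))}"
        by (rule cycle_edge_splits[OF step.hyps(2) sub(2) False ys F])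
      moreover have "card (X \<union> {a, b}) \<le> card X + 2" if "finite X" for X :: "complex set set" and a b
        using that by (simp add: card_insert_if)
      ultimately have "card (comps (insert e S)) \<le> card (comps S - {F}) + 2" "finite (comps (insert e S))"
        using c1(2) by simp_all
      then show ?thesis using c1 step.IH True False fin by (simp add: insert_absorb)
    next
      case vW: False
      have "comps (insert e S) \<subseteq> (comps S - {F}) \<union> {F - e}"
        using sub by (intro bridge_keeps_comps[OF step.hyps(2) sub(2) False step.hyps(3) sub(1)
          step.hyps(4) vW _ F]) blast
      then have fc: "finite (comps (insert e S))"
        and "card (comps (insert e S)) \<le> card (insert (F - e) (comps S - {F}))"
        using c1(2) by (auto intro: card_mono finite_subset)
      moreover have "card (insert (F - e) (comps S - {F})) \<le> card (comps S)"
        using c1 by (simp add: card_insert_if)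
      ultimately show ?thesis using step.IH vW False fin by simp
    qed
  qed
qed

text \<open>Only the edges that reach a new vertex are kept.\<close>

lemma conn_spanning_tree:
  assumes "conn W S"
  shows "\<exists>T\<subseteq>S. conn W T \<and> card T + 1 = card W"
  using assms
proof (induction rule: conn.induct)
  case (base v)
  then show ?case by (auto intro: conn.base)
next
  case (step W S e u v)
  then obtain T where T: "T \<subseteq> S" "conn W T" "card T + 1 = card W" by blast
  show ?case
  proof (cases "v \<in> W")
    case True
    then show ?thesis using T by (auto simp: insert_absorb)
  next
    case False
    have "e \<notin> T" using conn_subset(3)[OF T(2)] step.hyps False by blast
    then show ?thesis
      using T False conn_finite[OF T(2)] conn.step[OF T(2) step.hyps(2-4)]
      by (intro exI[of _ "insert e T"]) auto
  qed
qed

lemma conn_walk: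
  assumes "xs \<noteq> []" "set xs \<subseteq> V" "successively (adjacent V E) xs"
  shows "conn (set xs) (set (we xs))"
  using assms
proof (induction xs rule: induct_list012)
  case (2 x)
  then show ?case by (auto intro: conn.base)
next
  case (3 x y zs)
  have "edge_between x y \<in> E" "edge_between x y \<inter> V = {y, x}"
    using 3 adjacent_edge_between[of E x y] by auto
  then show ?case using conn.step[of "set (y # zs)" "set (we (y # zs))" "edge_between x y" y x] 3 by auto
qed simp

lemma conn_insert:
  assumes "conn V S" "e \<in> E"
  shows "conn V (insert e S)"
proof -
  obtain u v where "e \<inter> V = {u, v}" using edge_ends[OF assms(2)] .
  then show ?thesis using conn.step[OF assms, of u v] by (metis Int_iff insertCI insert_absorb)
qed

end

section \<open>Signed sums over faces\<close>

text \<open>The sign \<open>-1\<close> marks enclosed points, so a product over several cycles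
  records the parity of the number of cycles around a point.\<close>

definition side :: "complex set \<Rightarrow> complex \<Rightarrow> int" where
  "side C z = (if z \<in> inside C then - 1 else 1)"

lemma count_list_distinct: "distinct xs \<Longrightarrow> count_list xs x = (if x \<in> set xs then 1 else 0)"
  by (induction xs) auto

text \<open>Used for the change of colour across an edge, where \<open>c\<close> counts how often
  each cycle uses the edge.\<close>

lemma prod_list_sign_change:
  fixes f g :: "'a \<Rightarrow> int"
  assumes "\<And>x. x \<in> set xs \<Longrightarrow> f x = (- 1) ^ c x * g x"
  shows "(\<Prod>x\<leftarrow>xs. f x) = (- 1) ^ (\<Sum>x\<leftarrow>xs. c x) * (\<Prod>x\<leftarrow>xs. g x)"
  using assms by (induction xs) (auto simp: power_add)

text \<open>The opposite signs at \<open>a\<close> and \<open>b\<close> cancel, and every other term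
  has absolute value one.\<close>

lemma abs_sum_signs_le:
  fixes \<epsilon> :: "'a \<Rightarrow> int"
  assumes "finite A" "\<And>x. x \<in> A \<Longrightarrow> \<epsilon> x \<in> {- 1, 1}" "a \<in> A" "b \<in> A" "\<epsilon> a \<noteq> \<epsilon> b"
  shows "\<bar>sum \<epsilon> A\<bar> \<le> int (card A) - 2"
proof -
  have "a \<noteq> b" using assms(5) by blast
  have "sum \<epsilon> A = \<epsilon> a + (\<epsilon> b + sum \<epsilon> (A - {a} - {b}))"
    using assms(1,3,4) \<open>a \<noteq> b\<close> by (simp add: sum.remove)
  also have "\<dots> = sum \<epsilon> (A - {a} - {b})"
    using assms(2)[OF assms(3)] assms(2)[OF assms(4)] assms(5) by auto
  also have "\<bar>\<dots>\<bar> \<le> (\<Sum>x\<in>A - {a} - {b}. \<bar>\<epsilon> x\<bar>)" by (rule sum_abs)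
  also have "\<dots> = (\<Sum>x\<in>A - {a} - {b}. 1)" using assms(2) by (intro sum.cong) fastforce+
  also have "\<dots> = int (card A) - 2"
  proof -
    have "Suc (Suc (card (A - {a} - {b}))) = card A"
      using card_Suc_Diff1[of "A - {a}" b] card_Suc_Diff1[of A a] assms \<open>a \<noteq> b\<close> by simp
    then show ?thesis by simp
  qed
  finally show ?thesis .
qed

text \<open>Finiteness makes \<open>Min\<close> a lower bound of the set; all values lie between
  \<open>0\<close> and the fixed sum \<open>M\<close>.\<close>

lemma finite_grinberg_set: "finite (grinberg_set V E)"
proof -
  define M where "M = (\<Sum>F\<in>faces V E. \<bar>int (face_length E F) - 2\<bar>)"
  have "x \<in> {0..M}" if "x \<in> grinberg_set V E" for x
  proof -
    from that obtain \<epsilon> where x: "x = \<bar>\<Sum>F\<in>faces V E. \<epsilon> F * (int (face_length E F) - 2)\<bar>"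
      and \<epsilon>: "\<forall>F\<in>faces V E. \<epsilon> F \<in> {- 1, 1}"
      unfolding grinberg_set_def mem_Collect_eq by (elim exE conjE)
    have "x \<le> (\<Sum>F\<in>faces V E. \<bar>\<epsilon> F * (int (face_length E F) - 2)\<bar>)"
      unfolding x by (rule sum_abs)
    also have "\<dots> = M"
      unfolding M_def using \<epsilon> by (intro sum.cong) (auto simp: abs_mult)
    finally show ?thesis using x by simp
  qed
  then show ?thesis by (meson finite_atLeastAtMost_int finite_subset subsetI)
qed

section \<open>The colouring of the faces and the bound on its signed sum\<close>

context plane_graph
begin

text \<open>The curve is the frontier of its inside, and a connected set missing this frontier lies
  entirely on one side.\<close>

lemma side_constant:
  assumes "cycle E ys" "connected X" "X \<inter> \<Union>(cycle_edges ys) = {}" "z \<in> X" "w \<in> X"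
  shows "side (\<Union>(cycle_edges ys)) z = side (\<Union>(cycle_edges ys)) w"
proof -
  let ?C = "\<Union>(cycle_edges ys)"
  obtain c where c: "simple_path c" "pathfinish c = pathstart c" "path_image c = ?C"
    using cycle_jordan_curve[OF assms(1)] .
  then have fr: "frontier (inside ?C) = ?C" using Jordan_inside_outside[OF c(1,2)] by simp
  have "X \<subseteq> inside ?C \<or> X \<inter> inside ?C = {}"
    using connected_Int_frontier[OF assms(2), of "inside ?C"] assms(3) unfolding fr by blast
  then show ?thesis using assms(4,5) by (auto simp: side_def)
qed

lemma conn_superset:
  assumes "conn V S" "S \<subseteq> S'" "S' \<subseteq> E"
  shows "conn V S'"
proof -
  have "conn V (S \<union> Q)" if "finite Q" "Q \<subseteq> E" for Q
    using that
  proof induction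
    case (insert e Q)
    then show ?case using conn_insert[of "S \<union> Q" e] by simp
  qed (simp add: assms)
  from this[of S'] show ?thesis using assms finite_subset[OF _ finite_E] by (simp add: Un_absorb1)
qed

lemma conn_edge_closes_cycle:
  assumes "conn V S" "e \<in> E" "e \<notin> S"
  obtains ys where "cycle (insert e S) ys" "e \<in> cycle_edges ys"
proof -
  obtain u v where uv: "e \<inter> V = {u, v}" using edge_ends[OF assms(2)] .
  then have "(adjacent V S)\<^sup>*\<^sup>* u v" by (intro conn_reachable[OF assms(1)]) auto
  then show thesis
    using path_closes_to_cycle[OF assms(2) conn_subset(2)[OF assms(1)] assms(3) uv] that by blast
qed

lemma count_cycle_edges:
  "cycle E ys \<Longrightarrow> count_list (we (ys @ [hd ys])) e = (if e \<in> cycle_edges ys then 1 else 0)"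
  using closing_edge(6)[of ys] by (simp add: count_list_distinct)

text \<open>The faces are coloured by the parity of the number of cycles enclosing them. Colours are
  evaluated at arbitrary points of connected sets avoiding all cycles, so they make sense for the
  faces of every subgraph between \<open>S\<^sub>0\<close> and \<open>E\<close>.\<close>

lemma grinberg_number_le:
  assumes two: "card (faces V E) \<ge> 2" and S\<^sub>0: "conn V S\<^sub>0"
    and Cs: "\<And>ys. ys \<in> set Cs \<Longrightarrow> cycle E ys" "\<And>ys. ys \<in> set Cs \<Longrightarrow> cycle_edges ys \<subseteq> S\<^sub>0"
  defines "H \<equiv> {e \<in> E. odd (\<Sum>ys\<leftarrow>Cs. count_list (we (ys @ [hd ys])) e)}"
  assumes "H \<noteq> {}"
  shows "grinberg_number V E \<le> 2 * (int (card S\<^sub>0) + int (card (S\<^sub>0 - H)) - int (card V))"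
proof -
  have S0E: "S\<^sub>0 \<subseteq> E" using conn_subset[OF S\<^sub>0] by simp
  have finF: "finite (faces V E)" using two by (metis card.infinite not_numeral_le_zero)
  define col where "col z = (\<Prod>ys\<leftarrow>Cs. side (\<Union>(cycle_edges ys)) z)" for z
  define \<epsilon> where "\<epsilon> X = col (SOME z. z \<in> X)" for X
  have col_sign: "col z \<in> {- 1, 1}" for z
  proof -
    have "(\<Prod>ys\<leftarrow>Ds. side (\<Union>(cycle_edges ys)) z) \<in> {- 1, 1}" for Ds
      by (induction Ds) (auto simp: side_def)
    then show ?thesis unfolding col_def .
  qed
  then have \<epsilon>_sign: "\<epsilon> X \<in> {- 1, 1}" for X unfolding \<epsilon>_def by blast
  have col_const: "col z = col w" if "connected X" "X \<inter> drawing S\<^sub>0 = {}" "z \<in> X" "w \<in> X" for X z w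
  proof -
    have "X \<inter> \<Union>(cycle_edges ys) = {}" if "ys \<in> set Cs" for ys
      using Cs(2)[OF that] \<open>X \<inter> drawing S\<^sub>0 = {}\<close> unfolding drawing_def by blast
    then have "map (\<lambda>ys. side (\<Union>(cycle_edges ys)) z) Cs = map (\<lambda>ys. side (\<Union>(cycle_edges ys)) w) Cs"
      using side_constant[OF Cs(1)] that by (intro map_cong) blast+
    then show ?thesis unfolding col_def by (rule arg_cong)
  qed
  \<comment> \<open>A face, a piece of it and an edge interior within it thus get the same colour;
    this is how colours are compared between different subgraphs.\<close>
  have \<epsilon>_sub: "\<epsilon> X = \<epsilon> Y" if "X \<subseteq> Y" "X \<noteq> {}" "connected Y" "Y \<inter> drawing S\<^sub>0 = {}" for X Y
  proof -
    have "(SOME z. z \<in> X) \<in> X" "(SOME z. z \<in> Y) \<in> Y" using that by (auto intro: someI)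
    then show ?thesis unfolding \<epsilon>_def using that by (intro col_const[of Y]) auto
  qed
  have comp: "connected F" "F \<inter> drawing S\<^sub>0 = {}" "F \<noteq> {}" if "F \<in> comps S" "S\<^sub>0 \<subseteq> S" for F S
    using that in_components_connected in_components_nonempty in_components_subset drawing_mono
    by blast+

  let ?at = "\<lambda>e. {U \<in> faces V E. e \<subseteq> frontier U}"
  have on_cycle: "\<exists>ys\<in>set Cs. e \<in> cycle_edges ys" if "e \<in> H" for e
  proof (rule ccontr)
    assume "\<not> ?thesis"
    then have "\<forall>ys\<in>set Cs. count_list (we (ys @ [hd ys])) e = 0"
      by (simp add: count_list_0_iff)
    then have "(\<Sum>ys\<leftarrow>Cs. count_list (we (ys @ [hd ys])) e) = 0"
      by (simp add: sum_list_eq_0_iff)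
    moreover have "odd (\<Sum>ys\<leftarrow>Cs. count_list (we (ys @ [hd ys])) e)"
      using that unfolding H_def by blast
    ultimately show False by (metis even_zero)
  qed
  \<comment> \<open>Crossing \<open>e\<close> changes sides for exactly the cycles through
    \<open>e\<close>, and these are odd in number, each counted as often as it occurs in
    \<open>Cs\<close>.\<close>
  have at_H: "\<exists>U\<^sub>1 U\<^sub>2. ?at e = {U\<^sub>1, U\<^sub>2} \<and> U\<^sub>1 \<noteq> U\<^sub>2 \<and> \<epsilon> U\<^sub>1 = - \<epsilon> U\<^sub>2" if "e \<in> H" for e
  proof -
    have e: "e \<in> E" and odd: "odd (\<Sum>ys\<leftarrow>Cs. count_list (we (ys @ [hd ys])) e)"
      using that by (auto simp: H_def)
    from on_cycle[OF that]
    obtain ys where ys: "ys \<in> set Cs" "e \<in> cycle_edges ys" by blast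
    obtain F where F: "F \<in> comps (E - {e})" "e - V \<subseteq> F"
      using edge_in_comp[OF e, of "E - {e}"] by blast
    define U\<^sub>1 where "U\<^sub>1 = F \<inter> inside (\<Union>(cycle_edges ys))"
    define U\<^sub>2 where "U\<^sub>2 = F \<inter> outside (\<Union>(cycle_edges ys))"
    have U: "?at e = {U\<^sub>1, U\<^sub>2}" "U\<^sub>1 \<noteq> {}" "U\<^sub>2 \<noteq> {}" "U\<^sub>1 \<inter> U\<^sub>2 = {}"
      using faces_at_cycle_edge[OF Cs(1)[OF ys(1)] ys(2) F] unfolding U\<^sub>1_def U\<^sub>2_def by blast+
    define z\<^sub>1 where "z\<^sub>1 = (SOME z. z \<in> U\<^sub>1)"
    define z\<^sub>2 where "z\<^sub>2 = (SOME z. z \<in> U\<^sub>2)"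
    have z: "z\<^sub>1 \<in> U\<^sub>1" "z\<^sub>2 \<in> U\<^sub>2" using U(2,3) unfolding z\<^sub>1_def z\<^sub>2_def by (auto intro: someI)
    have zF: "z\<^sub>1 \<in> F" "z\<^sub>2 \<in> F" using z unfolding U\<^sub>1_def U\<^sub>2_def by auto
    have "side (\<Union>(cycle_edges zs)) z\<^sub>1
        = (- 1) ^ count_list (we (zs @ [hd zs])) e * side (\<Union>(cycle_edges zs)) z\<^sub>2"
      if "zs \<in> set Cs" for zs
    proof (cases "e \<in> cycle_edges zs")
      case True
      let ?C = "\<Union>(cycle_edges zs)"
      note at = faces_at_cycle_edge[OF Cs(1)[OF that] True F]
      \<comment> \<open>Another cycle through \<open>e\<close> has the same two faces at
        \<open>e\<close>, possibly with inside and outside exchanged.\<close>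
      have dbl: "{U\<^sub>1, U\<^sub>2} = {F \<inter> inside ?C, F \<inter> outside ?C}" using at(1) U(1) by simp
      then consider "U\<^sub>1 = F \<inter> inside ?C" "U\<^sub>2 = F \<inter> outside ?C"
        | "U\<^sub>2 = F \<inter> inside ?C" "U\<^sub>1 = F \<inter> outside ?C" by (auto simp: doubleton_eq_iff)
      then have "side ?C z\<^sub>1 = - side ?C z\<^sub>2"
      proof cases
        case 1
        then have "z\<^sub>1 \<in> inside ?C" "z\<^sub>2 \<notin> inside ?C" using z at(4) by blast+
        then show ?thesis by (simp add: side_def)
      next
        case 2
        then have "z\<^sub>2 \<in> inside ?C" "z\<^sub>1 \<notin> inside ?C" using z at(4) by blast+
        then show ?thesis by (simp add: side_def)
      qed
      then show ?thesis using count_cycle_edges[OF Cs(1)[OF that], of e] True by simp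
    next
      case False
      \<comment> \<open>A cycle without \<open>e\<close> misses \<open>F\<close>, which is connected
        and contains both sample points.\<close>
      have "\<Union>(cycle_edges zs) \<subseteq> drawing (E - {e})"
        using cycle_edges_subset[OF Cs(1)[OF that]] False unfolding drawing_def by blast
      moreover have "F \<inter> drawing (E - {e}) = {}" using in_components_subset[OF F(1)] by blast
      ultimately have "F \<inter> \<Union>(cycle_edges zs) = {}" by blast
      then have "side (\<Union>(cycle_edges zs)) z\<^sub>1 = side (\<Union>(cycle_edges zs)) z\<^sub>2"
        using side_constant[OF Cs(1)[OF that] in_components_connected[OF F(1)]] zF by blast
      then show ?thesis using count_cycle_edges[OF Cs(1)[OF that], of e] False by simp
    qed
    then have "col z\<^sub>1 = (- 1) ^ (\<Sum>ys\<leftarrow>Cs. count_list (we (ys @ [hd ys])) e) * col z\<^sub>2"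
      unfolding col_def by (rule prod_list_sign_change)
    then have "\<epsilon> U\<^sub>1 = - \<epsilon> U\<^sub>2" using odd by (simp add: \<epsilon>_def z\<^sub>1_def z\<^sub>2_def)
    then show ?thesis using U by blast
  qed

  \<comment> \<open>The edge and both pieces inherit the colour of \<open>F\<close>. The last
    conjunct, for the graph lacking only \<open>e\<close>, identifies the pieces with the faces at
    \<open>e\<close>.\<close>
  have at_new: "\<exists>U\<^sub>1 U\<^sub>2 F. F \<in> comps S \<and> comps (insert e S) = (comps S - {F}) \<union> {U\<^sub>1, U\<^sub>2} \<and>
      U\<^sub>1 \<noteq> U\<^sub>2 \<and> U\<^sub>1 \<notin> comps S - {F} \<and> U\<^sub>2 \<notin> comps S - {F} \<and>
      \<epsilon> U\<^sub>1 = \<epsilon> (e - V) \<and> \<epsilon> U\<^sub>2 = \<epsilon> (e - V) \<and> \<epsilon> F = \<epsilon> (e - V) \<and>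
      (S = E - {e} \<longrightarrow> ?at e = {U\<^sub>1, U\<^sub>2})"
    if S: "S\<^sub>0 \<subseteq> S" "S \<subseteq> E" and e: "e \<in> E" "e \<notin> S" for S e
  proof -
    obtain ys where ys: "cycle (insert e S) ys" "e \<in> cycle_edges ys"
      using conn_edge_closes_cycle[OF conn_superset[OF S\<^sub>0 S] e] .
    obtain F where F: "F \<in> comps S" "e - V \<subseteq> F" using edge_in_comp[OF e(1) S(2) e(2)] .
    define U\<^sub>1 where "U\<^sub>1 = F \<inter> inside (\<Union>(cycle_edges ys))"
    define U\<^sub>2 where "U\<^sub>2 = F \<inter> outside (\<Union>(cycle_edges ys))"
    note split = cycle_edge_splits[OF e(1) S(2) e(2) ys F, folded U\<^sub>1_def U\<^sub>2_def]
    have disj: "U\<^sub>1 \<inter> U\<^sub>2 = {}" using split(6) unfolding U\<^sub>1_def U\<^sub>2_def by blast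
    have sub: "U\<^sub>1 \<subseteq> F" "U\<^sub>2 \<subseteq> F" unfolding U\<^sub>1_def U\<^sub>2_def by auto
    have eF: "\<epsilon> X = \<epsilon> F" if "X \<subseteq> F" "X \<noteq> {}" for X
      using \<epsilon>_sub[OF that] comp[OF F(1) S(1)] by blast
    have cols: "\<epsilon> U\<^sub>1 = \<epsilon> (e - V)" "\<epsilon> U\<^sub>2 = \<epsilon> (e - V)" "\<epsilon> F = \<epsilon> (e - V)"
      using eF[OF sub(1) split(4)] eF[OF sub(2) split(5)] eF[OF F(2) edge_interior(2)[OF e(1)]] by simp_all
    have new: "X \<notin> comps S - {F}" if "X \<subseteq> F" "X \<noteq> {}" for X
      using that F(1) components_nonoverlap[of X "- drawing S" F] by blast
    have at: "?at e = {U\<^sub>1, U\<^sub>2}" if "S = E - {e}"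
    proof -
      have "cycle E ys" using ys(1) S(2) e(1) by (auto intro: cycle_mono)
      then show ?thesis
        using faces_at_cycle_edge(1)[of ys e F] ys(2) F that unfolding U\<^sub>1_def U\<^sub>2_def by simp
    qed
    have "U\<^sub>1 \<noteq> U\<^sub>2" using disj split(4) by blast
    then show ?thesis
      by (intro exI[of _ U\<^sub>1] exI[of _ U\<^sub>2] exI[of _ F] conjI impI F(1) split(1) cols at
          new[OF sub(1) split(4)] new[OF sub(2) split(5)])
  qed

  have sum_H: "sum \<epsilon> (?at e) = 0" if "e \<in> H" for e
  proof -
    from at_H[OF that] obtain U\<^sub>1 U\<^sub>2
      where "?at e = {U\<^sub>1, U\<^sub>2}" "U\<^sub>1 \<noteq> U\<^sub>2" "\<epsilon> U\<^sub>1 = - \<epsilon> U\<^sub>2"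
      by blast
    then show ?thesis by simp
  qed
  have sum_Q: "sum \<epsilon> (?at e) = 2 * \<epsilon> (e - V)" if "e \<in> E - S\<^sub>0" for e
  proof -
    have "S\<^sub>0 \<subseteq> E - {e}" "E - {e} \<subseteq> E" "e \<in> E" "e \<notin> E - {e}" using that S0E by auto
    from at_new[OF this] obtain U\<^sub>1 U\<^sub>2 where "U\<^sub>1 \<noteq> U\<^sub>2"
      "\<epsilon> U\<^sub>1 = \<epsilon> (e - V)" "\<epsilon> U\<^sub>2 = \<epsilon> (e - V)" "E - {e} = E - {e} \<longrightarrow> ?at e = {U\<^sub>1, U\<^sub>2}"
      by (elim exE conjE) (rule that)
    then show ?thesis by simp
  qed
  have sum_T: "\<bar>sum \<epsilon> (?at e)\<bar> \<le> 2" if e: "e \<in> E" for e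
  proof -
    \<comment> \<open>An edge on a cycle borders two faces, and a bridge at most one.\<close>
    have "card (?at e) \<le> 2"
    proof (cases "\<exists>ys. cycle E ys \<and> e \<in> cycle_edges ys")
      case True
      then obtain ys where ys: "cycle E ys" "e \<in> cycle_edges ys" by blast
      obtain F where F: "F \<in> comps (E - {e})" "e - V \<subseteq> F"
        using edge_in_comp[OF e, of "E - {e}"] by blast
      show ?thesis unfolding faces_at_cycle_edge(1)[OF ys F] by (simp add: card_insert_if)
    next
      case False
      then obtain F where "?at e \<subseteq> {F}" using faces_at_bridge[OF e] by blast
      then have "card (?at e) \<le> card {F}" by (intro card_mono) auto
      then show ?thesis by simp
    qed
    moreover have "\<bar>sum \<epsilon> (?at e)\<bar> \<le> (\<Sum>U\<in>?at e. \<bar>\<epsilon> U\<bar>)" by (rule sum_abs)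
    moreover have "(\<Sum>U\<in>?at e. \<bar>\<epsilon> U\<bar>) = (\<Sum>U\<in>?at e. 1)"
      using \<epsilon>_sign by (intro sum.cong refl) (metis abs_1 abs_minus_cancel empty_iff insert_iff)
    ultimately show ?thesis by simp
  qed

  \<comment> \<open>Each further edge replaces one face by two of the same colour, so the sum of the
    colours grows by this colour.\<close>
  have adding: "sum \<epsilon> (comps (S\<^sub>0 \<union> Q)) = sum \<epsilon> (comps S\<^sub>0) + (\<Sum>e\<in>Q. \<epsilon> (e - V))"
    if "finite Q" "Q \<subseteq> E - S\<^sub>0" for Q
    using that
  proof induction
    case (insert e Q)
    let ?S = "S\<^sub>0 \<union> Q"
    have S: "S\<^sub>0 \<subseteq> ?S" "?S \<subseteq> E" "e \<in> E" "e \<notin> ?S" using insert.hyps insert.prems S0E by auto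
    from at_new[OF S] obtain U\<^sub>1 U\<^sub>2 F where *: "F \<in> comps ?S" "comps (insert e ?S) = (comps ?S - {F}) \<union> {U\<^sub>1, U\<^sub>2}"
      "U\<^sub>1 \<noteq> U\<^sub>2" "U\<^sub>1 \<notin> comps ?S - {F}" "U\<^sub>2 \<notin> comps ?S - {F}"
      "\<epsilon> U\<^sub>1 = \<epsilon> (e - V)" "\<epsilon> U\<^sub>2 = \<epsilon> (e - V)" "\<epsilon> F = \<epsilon> (e - V)"
      by (elim exE conjE) (rule that)
    have fin: "finite (comps ?S)" using card_comps_conn[OF conn_superset[OF S\<^sub>0 S(1,2)]] by simp
    have "sum \<epsilon> (comps (insert e ?S)) = \<epsilon> U\<^sub>1 + (\<epsilon> U\<^sub>2 + sum \<epsilon> (comps ?S - {F}))"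
      unfolding *(2) using *(3-5) fin by simp
    also have "\<dots> = \<epsilon> (e - V) + sum \<epsilon> (comps ?S)"
      using sum.remove[OF fin *(1), of \<epsilon>] *(6-8) by simp
    finally show ?case using insert by simp
  qed simp

  \<comment> \<open>The two faces at an edge of \<open>H\<close> have opposite colours. This rules
    out a constant sign vector, both for the faces and for the components of
    \<open>S\<^sub>0\<close> that contain them.\<close>
  obtain e\<^sub>0 where "e\<^sub>0 \<in> H" using \<open>H \<noteq> {}\<close> by blast
  from at_H[OF this] obtain U\<^sub>1 U\<^sub>2
    where U: "?at e\<^sub>0 = {U\<^sub>1, U\<^sub>2}" "\<epsilon> U\<^sub>1 = - \<epsilon> U\<^sub>2"
    by (elim exE conjE) (rule that)
  have "U\<^sub>1 \<in> ?at e\<^sub>0" "U\<^sub>2 \<in> ?at e\<^sub>0" unfolding U(1) by simp_all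
  then have Uf: "U\<^sub>1 \<in> faces V E" "U\<^sub>2 \<in> faces V E" by simp_all
  have ne: "\<epsilon> U\<^sub>1 \<noteq> \<epsilon> U\<^sub>2" using U(2) \<epsilon>_sign[of U\<^sub>2] by auto
  have S0_comp: "\<exists>G\<in>comps S\<^sub>0. \<epsilon> G = \<epsilon> U" if "U \<in> faces V E" for U
  proof -
    have "U \<in> comps E" using that by (simp add: faces_eq)
    note U = comp[OF this S0E]
    have "U \<subseteq> - drawing S\<^sub>0" "- drawing S\<^sub>0 \<noteq> {}" using U(2,3) by blast+
    from exists_component_superset[OF this U(1)]
    obtain G where G: "G \<in> comps S\<^sub>0" "U \<subseteq> G" by (elim exE conjE) (rule that)
    have "\<epsilon> U = \<epsilon> G"
      using G(2) U(3) comp(1,2)[OF G(1) order_refl] by (rule \<epsilon>_sub)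
    with G(1) show ?thesis by (intro bexI[of _ G]) simp_all
  qed
  have "\<bar>sum \<epsilon> (comps S\<^sub>0)\<bar> \<le> int (card (comps S\<^sub>0)) - 2"
  proof -
    obtain G\<^sub>1 G\<^sub>2 where "G\<^sub>1 \<in> comps S\<^sub>0" "G\<^sub>2 \<in> comps S\<^sub>0" "\<epsilon> G\<^sub>1 \<noteq> \<epsilon> G\<^sub>2"
      using S0_comp[OF Uf(1)] S0_comp[OF Uf(2)] ne by metis
    then show ?thesis using card_comps_conn[OF S\<^sub>0] \<epsilon>_sign by (intro abs_sum_signs_le) auto
  qed
  then have S0_bound: "\<bar>sum \<epsilon> (comps S\<^sub>0)\<bar> \<le> int (card S\<^sub>0) - int (card V)"
    using card_comps_conn[OF S\<^sub>0] by linarith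

  have HS0: "H \<subseteq> S\<^sub>0"
  proof
    fix e assume "e \<in> H"
    then show "e \<in> S\<^sub>0" using on_cycle Cs(2) by blast
  qed
  let ?\<Sigma> = "\<Sum>F\<in>faces V E. \<epsilon> F * (int (face_length E F) - 2)"
  \<comment> \<open>Double counting: the face lengths are summed edge by edge.\<close>
  have "(\<Sum>F\<in>faces V E. \<epsilon> F * int (face_length E F))
      = (\<Sum>F\<in>faces V E. \<Sum>e\<in>{e\<in>E. e \<subseteq> frontier F}. \<epsilon> F)"
    by (simp add: face_length_def mult.commute)
  also have "\<dots> = (\<Sum>e\<in>E. sum \<epsilon> (?at e))"
    using finF finite_E by (rule sum.swap_restrict)
  also have "\<dots> = (\<Sum>e\<in>E - S\<^sub>0. sum \<epsilon> (?at e)) + (\<Sum>e\<in>S\<^sub>0 - H. sum \<epsilon> (?at e)) + (\<Sum>e\<in>H. sum \<epsilon> (?at e))"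
    using sum.subset_diff[OF S0E finite_E, of "\<lambda>e. sum \<epsilon> (?at e)"]
      sum.subset_diff[OF HS0 finite_subset[OF S0E finite_E], of "\<lambda>e. sum \<epsilon> (?at e)"] by simp
  also have "(\<Sum>e\<in>E - S\<^sub>0. sum \<epsilon> (?at e)) = 2 * (\<Sum>e\<in>E - S\<^sub>0. \<epsilon> (e - V))"
    unfolding sum_distrib_left using sum_Q by (intro sum.cong) auto
  \<comment> \<open>By \<open>adding\<close>, the edges outside \<open>S\<^sub>0\<close> account for
    the difference of the two colour sums; the first of these cancels the \<open>- 2\<close> of all
    faces.\<close>
  also have "\<dots> = 2 * sum \<epsilon> (faces V E) - 2 * sum \<epsilon> (comps S\<^sub>0)"
    using adding[of "E - S\<^sub>0"] finite_E S0E by (simp add: faces_eq Un_absorb1)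
  also have "(\<Sum>e\<in>H. sum \<epsilon> (?at e)) = 0"
    using sum_H by (intro sum.neutral) blast
  finally have eq: "?\<Sigma> = (\<Sum>e\<in>S\<^sub>0 - H. sum \<epsilon> (?at e)) - 2 * sum \<epsilon> (comps S\<^sub>0)"
    by (simp add: right_diff_distrib sum_subtractf sum_distrib_left mult.commute)
  have T_bound: "\<bar>\<Sum>e\<in>S\<^sub>0 - H. sum \<epsilon> (?at e)\<bar> \<le> 2 * int (card (S\<^sub>0 - H))"
  proof -
    have "\<bar>\<Sum>e\<in>S\<^sub>0 - H. sum \<epsilon> (?at e)\<bar> \<le> (\<Sum>e\<in>S\<^sub>0 - H. \<bar>sum \<epsilon> (?at e)\<bar>)" by (rule sum_abs)
    also have "\<dots> \<le> (\<Sum>e\<in>S\<^sub>0 - H. 2)" using sum_T S0E by (intro sum_mono) auto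
    finally show ?thesis by simp
  qed
  have "\<bar>?\<Sigma>\<bar> \<le> 2 * (int (card S\<^sub>0) + int (card (S\<^sub>0 - H)) - int (card V))"
    unfolding eq using T_bound S0_bound by (simp add: abs_le_iff)
  moreover have "\<bar>?\<Sigma>\<bar> \<in> grinberg_set V E"
    unfolding grinberg_set_def using \<epsilon>_sign Uf ne by blast
  then have "grinberg_number V E \<le> \<bar>?\<Sigma>\<bar>"
    unfolding grinberg_number_def using finite_grinberg_set by (intro Min_le)
  ultimately show ?thesis by (rule order_trans[rotated])
qed

end

section \<open>From the closed walk to the inequality\<close>

lemma closed_spanning_walk_successively:
  assumes "closed_spanning_walk V E vs"
  shows "successively (adjacent V E) (vs @ [hd vs])"
proof -
  have ne: "vs \<noteq> []" and adj: "\<And>i. i < length vs \<Longrightarrow> adjacent V E (vs ! i) (vs ! (Suc i mod length vs))"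
    using assms unfolding closed_spanning_walk_def by auto
  show ?thesis
    unfolding successively_conv_nth
  proof (intro allI impI)
    fix i assume i: "Suc i < length (vs @ [hd vs])"
    show "adjacent V E ((vs @ [hd vs]) ! i) ((vs @ [hd vs]) ! Suc i)"
      using adj[of i] i ne by (cases "Suc i = length vs") (auto simp: nth_append hd_conv_nth)
  qed
qed

theorem theorem1:
  fixes V :: "complex set" and E :: "complex set set" and vs :: "complex list"
  assumes "plane_graph V E"
    and "card (faces V E) \<ge> 2"
    and "closed_spanning_walk V E vs"
  shows "(\<Sum>v\<in>V. real (count_list vs v) - 1) \<ge> real_of_int (grinberg_number V E) / 2"
proof -
  interpret plane_graph V E by fact
  have vs: "vs \<noteq> []" "set vs = V" using assms(3) unfolding closed_spanning_walk_def by auto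
  define xs where "xs = vs @ [hd vs]"
  have xs: "xs \<noteq> []" "set xs = V" "hd xs = last xs" "successively (adjacent V E) xs"
    using vs closed_spanning_walk_successively[OF assms(3)] by (auto simp: xs_def)
  define S where "S = set (we xs)"
  have S: "conn V S" "finite S" "S \<subseteq> E"
    using conn_walk[of xs] xs conn_finite conn_subset unfolding S_def by auto
  define H where "H = {e \<in> E. odd (count_list (we xs) e)}"
  have HS: "H \<subseteq> S"
    unfolding H_def S_def by (auto simp: count_list_0_iff) (metis count_list_0_iff even_zero)
  \<comment> \<open>Edges of \<open>S - H\<close> have positive even count, so the walk uses them at
    least twice.\<close>
  have len: "int (card S) + int (card (S - H)) \<le> int (length vs)"
  proof -
    have "card S + card (S - H) = (\<Sum>e\<in>S. if e \<in> H then 1 else 2)"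
      using sum.subset_diff[OF HS S(2), of "\<lambda>e. if e \<in> H then 1 else 2 :: nat"]
        sum.subset_diff[OF HS S(2), of "\<lambda>_. 1 :: nat"] by simp
    also have "\<dots> \<le> (\<Sum>e\<in>S. count_list (we xs) e)"
    proof (rule sum_mono)
      fix e assume "e \<in> S"
      then have "count_list (we xs) e \<noteq> 0" "e \<in> E" using S(3) by (auto simp: S_def count_list_0_iff)
      then show "(if e \<in> H then 1 else 2) \<le> count_list (we xs) e"
        by (auto simp: H_def elim!: evenE)
    qed
    also have "\<dots> = length (we xs)" unfolding S_def using S(2) by (intro sum_count_set) auto
    also have "\<dots> = length vs" by (simp add: length_walk_edges xs_def)
    finally show ?thesis by simp
  qed
  have "grinberg_number V E \<le> 2 * (int (length vs) - int (card V))"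
  proof (cases "H = {}")
    case False
    obtain Cs where Cs: "\<forall>ys\<in>set Cs. distinct ys \<and> 3 \<le> length ys \<and>
        successively (adjacent V E) (ys @ [hd ys]) \<and> cycle_edges ys \<subseteq> S"
      and even: "\<forall>e. even (count_list (we xs) e) = even (\<Sum>ys\<leftarrow>Cs. count_list (we (ys @ [hd ys])) e)"
      using closed_walk_cycle_decomposition[of edge_between "adjacent V E" xs]
        edge_between_commute adjacent_irrefl[of E] xs unfolding S_def by blast
    have H: "H = {e \<in> E. odd (\<Sum>ys\<leftarrow>Cs. count_list (we (ys @ [hd ys])) e)}"
      unfolding H_def using even by simp
    have "grinberg_number V E \<le> 2 * (int (card S) + int (card (S - H)) - int (card V))"
      unfolding H by (rule grinberg_number_le[OF assms(2) S(1)])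
        (use Cs False H in \<open>auto simp: cycle_def\<close>)
    then show ?thesis using len unfolding right_diff_distrib distrib_left by linarith
  next
    \<comment> \<open>Now every edge of \<open>S\<close> is used at least twice. A spanning tree has
      at most one face, so some edge lies outside it and closes a cycle, which replaces the empty
      \<open>H\<close>.\<close>
    case True
    obtain T where T: "conn V T" "card T + 1 = card V" using conn_spanning_tree[OF S(1)] by blast
    have TE: "T \<subseteq> E" using conn_subset[OF T(1)] by simp
    have "card (comps T) \<le> 1" using card_comps_conn[OF T(1)] T(2) by linarith
    then have "T \<noteq> E" using assms(2) faces_eq by auto
    then obtain e where e: "e \<in> E" "e \<notin> T" using TE by blast
    obtain ys where ys: "cycle (insert e T) ys"
      using conn_edge_closes_cycle[OF T(1) e] .
    have cyc: "cycle E ys" using ys TE e by (auto intro: cycle_mono)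
    have sub: "cycle_edges ys \<subseteq> insert e T" using cycle_edges_subset[OF ys] TE e by blast
    have Hc: "{d \<in> E. odd (\<Sum>ys\<leftarrow>[ys]. count_list (we (ys @ [hd ys])) d)} = cycle_edges ys"
      using count_cycle_edges[OF cyc] sub TE e by auto
    have k: "card (cycle_edges ys) \<ge> 3" using card_cycle_edges[OF cyc] cyc by (simp add: cycle_def)
    then have "cycle_edges ys \<noteq> {}" by auto
    \<comment> \<open>As \<open>insert e T\<close> has \<open>card V\<close> edges, the right side
      is twice the difference of \<open>card V\<close> and the cycle length, which is at least
      three, while the walk has length at least \<open>2 * (card V - 1)\<close>.\<close>
    then have "grinberg_number V E \<le>
        2 * (int (card (insert e T)) + int (card (insert e T - cycle_edges ys)) - int (card V))"
      using grinberg_number_le[OF assms(2) conn_insert[OF T(1) e(1)], of "[ys]"] cyc sub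
      unfolding Hc by simp
    moreover have cV: "card (insert e T) = card V" using T e conn_finite[OF T(1)] by simp
    moreover have "card (insert e T - cycle_edges ys) + card (cycle_edges ys) = card V"
      using sub cV card_mono[OF _ sub] conn_finite[OF T(1)] by (simp add: card_Diff_subset)
    moreover have "card V \<le> card S + 1"
    proof -
      obtain T' where T': "T' \<subseteq> S" "card T' + 1 = card V" using conn_spanning_tree[OF S(1)] by blast
      then show ?thesis using card_mono[OF S(2) T'(1)] by linarith
    qed
    moreover have "2 * card S \<le> length vs" using len True by simp
    ultimately show ?thesis using k unfolding right_diff_distrib distrib_left by linarith
  qed
  \<comment> \<open>The list omits the final return, so the counts add up to its length.\<close>
  moreover have "(\<Sum>v\<in>V. real (count_list vs v) - 1) = real (length vs) - real (card V)"
    using sum_count_set[of vs V] vs finite_V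
    by (simp add: sum_subtractf flip: of_nat_sum)
  moreover have "real_of_int (grinberg_number V E) \<le> 2 * (real (length vs) - real (card V))"
    using calculation(1)[folded of_int_le_iff[where 'a = real]] by simp
  ultimately show ?thesis by simp
qed

end
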